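(* Let $\mathcal{O}$ be a Euclidean oriented matroid on ground set $E$ and let $\mathcal{O}\cup p$ be a lexicographic extension of $\mathcal{O}$. Then for every $f\in E$ such that $(\mathcal{O}\cup p,p,f)$ is an oriented matroid program, $(\mathcal{O}\cup p,p,f)$ is a Euclidean oriented matroid program.
   Context: An oriented matroid $\mathcal{O}$ on a finite ground set $E$ is given by its set of covectors in $\{+,-,0\}^E$; cocircuits are the minimal nonzero covectors. For a sign vector $X$, $X_e$ is its $e$-entry, $\mathrm{supp}(X)=\{e:X_e\neq 0\}$, $z(X)=E\setminus \mathrm{supp}(X)$, $(X\circ Y)_e=X_e$ if $X_e\ne0$ and $Y_e$ otherwise, $\mathrm{sep}(X,Y)=\{e: X_e=-Y_e\neq 0\}$; $X,Y$ are conformal if $\mathrm{sep}(X,Y)=\emptyset$. Let $r$ be the rank of the underlying matroid $\mathcal{M}(\mathcal{O})$. Two cocircuits $X\neq\pm Y$ are comodular if $z(X),z(Y)$ form a modular pair in $\mathcal{M}(\mathcal{O})$, equivalently $z(X\circ Y)$ is a flat of rank $r-2$. For comodular $X,Y$ and $e\in\mathrm{sep}(X,Y)$, cocircuit elimination of $e$ between $X$ and $Y$ yields the unique cocircuit $Z$ with $Z_e=0$ and $\mathrm{supp}(Z)\subseteq \mathrm{supp}(X\circ Y)\setminus\{e\}$. An oriented matroid program $(\mathcal{O},g,f)$ consists of $\mathcal{O}$ and distinct $g,f\in E$ with $g$ not a loop and $f$ not a coloop. For comodular cocircuits $X,Y$ with $X_g=Y_g\neq0$ let $Z$ be obtained by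 elimination of $g$ between $-X$ and $Y$; write $X\to Y$ if $Z_f=+$, $X\leftarrow Y$ if $Z_f=-$, and $X\leftrightarrow Y$ (undirected) if $Z_f=0$. The graph $G_f$ of $(\mathcal{O},g,f)$ has as vertices the cocircuits $Y$ with $Y_g=+$, and an edge between any two conformal comodular cocircuits, directed as just described. A directed cycle in $G_f$ is a sequence $P^1,\dots,P^n=P^1$ with $P^1,\dots,P^{n-1}$ pairwise distinct, consecutive entries adjacent, $P^i\to P^{i+1}$ or $P^i\leftrightarrow P^{i+1}$ for all $i$, and not all edges undirected. $(\mathcal{O},g,f)$ is Euclidean if $G_f$ has no directed cycle; $\mathcal{O}$ is Euclidean if every program $(\mathcal{O},g,f)$ ($g\neq f$, $g$ not a loop, $f$ not a coloop) is Euclidean. For an ordered subset $I=[e_1,\dots,e_k]$ of $E$ and $\alpha\in\{+,-\}^k$, the lexicographic extension $\mathcal{O}[e_1^{\alpha_1},\dots,e_k^{\alpha_k}]=\mathcal{O}\cup p$ is the single-element extension by a new element $p$ with localization $\sigma(Y)=\alpha_iY_{e_i}$ on cocircuits $Y$, where $i$ is the smallest index with $Y_{e_i}\neq 0$, and $\sigma(Y)=0$ if $Y_{e_1}=\dots=Y_{e_k}=0$. *)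

theory Defs
  imports Main
begin

text \<open>A sign vector on a ground set \<open>E :: 'a set\<close> is a function with values in
  \<open>{-1, 0, 1}\<close> that vanishes outside \<open>E\<close>, so that equality of functions is equality
  of sign vectors and \<open>- X\<close> is the pointwise negation.\<close>

type_synonym 'a sign_vec = "'a \<Rightarrow> int"

definition sign_vectors :: "'a set \<Rightarrow> 'a sign_vec set" where
  "sign_vectors E = {X. (\<forall>e\<in>E. X e \<in> {-1, 0, 1}) \<and> (\<forall>e. e \<notin> E \<longrightarrow> X e = 0)}"

definition supp :: "'a sign_vec \<Rightarrow> 'a set" where
  "supp X = {e. X e \<noteq> 0}"

definition zero_set :: "'a set \<Rightarrow> 'a sign_vec \<Rightarrow> 'a set" where
  "zero_set E X = E - supp X"

definition sv_comp :: "'a sign_vec \<Rightarrow> 'a sign_vec \<Rightarrow> 'a sign_vec" where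
  "sv_comp X Y = (\<lambda>e. if X e \<noteq> 0 then X e else Y e)"

definition sep :: "'a sign_vec \<Rightarrow> 'a sign_vec \<Rightarrow> 'a set" where
  "sep X Y = {e. X e = - Y e \<and> X e \<noteq> 0}"

definition conformal :: "'a sign_vec \<Rightarrow> 'a sign_vec \<Rightarrow> bool" where
  "conformal X Y \<longleftrightarrow> sep X Y = {}"

text \<open>The covector axioms; \<open>L\<close> is the set of covectors.\<close>

definition oriented_matroid :: "'a set \<Rightarrow> 'a sign_vec set \<Rightarrow> bool" where
  "oriented_matroid E L \<longleftrightarrow>
     finite E \<and> L \<subseteq> sign_vectors E \<and>
     (\<lambda>_. 0) \<in> L \<and>
     (\<forall>X\<in>L. - X \<in> L) \<and>
     (\<forall>X\<in>L. \<forall>Y\<in>L. sv_comp X Y \<in> L) \<and>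
     (\<forall>X\<in>L. \<forall>Y\<in>L. \<forall>e\<in>sep X Y. \<exists>Z\<in>L. Z e = 0 \<and>
        (\<forall>h\<in>E - sep X Y. Z h = sv_comp X Y h))"

text \<open>The order on sign vectors induced componentwise by \<open>0 < +\<close> and \<open>0 < -\<close>.\<close>

definition face_le :: "'a sign_vec \<Rightarrow> 'a sign_vec \<Rightarrow> bool" where
  "face_le X Y \<longleftrightarrow> (\<forall>e. X e = 0 \<or> X e = Y e)"

definition cocircuits :: "'a sign_vec set \<Rightarrow> 'a sign_vec set" where
  "cocircuits L = {X \<in> L. X \<noteq> (\<lambda>_. 0) \<and>
     (\<forall>Y\<in>L. Y \<noteq> (\<lambda>_. 0) \<and> face_le Y X \<longrightarrow> Y = X)}"

text \<open>The underlying matroid is the matroid on \<open>E\<close> whose flats are the zero sets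
  of the covectors.\<close>

definition flats :: "'a set \<Rightarrow> 'a sign_vec set \<Rightarrow> 'a set set" where
  "flats E L = zero_set E ` L"

definition mat_closure :: "'a set \<Rightarrow> 'a sign_vec set \<Rightarrow> 'a set \<Rightarrow> 'a set" where
  "mat_closure E L A = \<Inter> {F \<in> flats E L. A \<subseteq> F}"

definition mat_indep :: "'a set \<Rightarrow> 'a sign_vec set \<Rightarrow> 'a set \<Rightarrow> bool" where
  "mat_indep E L A \<longleftrightarrow> A \<subseteq> E \<and> (\<forall>e\<in>A. e \<notin> mat_closure E L (A - {e}))"

definition mat_basis :: "'a set \<Rightarrow> 'a sign_vec set \<Rightarrow> 'a set \<Rightarrow> bool" where
  "mat_basis E L B \<longleftrightarrow> mat_indep E L B \<and> (\<forall>A. mat_indep E L A \<and> B \<subseteq> A \<longrightarrow> A = B)"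

definition mat_rank :: "'a set \<Rightarrow> 'a sign_vec set \<Rightarrow> 'a set \<Rightarrow> nat" where
  "mat_rank E L A = Max (card ` {B. B \<subseteq> A \<and> mat_indep E L B})"

definition mat_loop :: "'a set \<Rightarrow> 'a sign_vec set \<Rightarrow> 'a \<Rightarrow> bool" where
  "mat_loop E L e \<longleftrightarrow> e \<in> E \<and> \<not> mat_indep E L {e}"

definition mat_coloop :: "'a set \<Rightarrow> 'a sign_vec set \<Rightarrow> 'a \<Rightarrow> bool" where
  "mat_coloop E L e \<longleftrightarrow> e \<in> E \<and> (\<forall>B. mat_basis E L B \<longrightarrow> e \<in> B)"

definition modular_pair :: "'a set \<Rightarrow> 'a sign_vec set \<Rightarrow> 'a set \<Rightarrow> 'a set \<Rightarrow> bool" where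
  "modular_pair E L A B \<longleftrightarrow>
     mat_rank E L A + mat_rank E L B = mat_rank E L (A \<union> B) + mat_rank E L (A \<inter> B)"

definition comodular :: "'a set \<Rightarrow> 'a sign_vec set \<Rightarrow> 'a sign_vec \<Rightarrow> 'a sign_vec \<Rightarrow> bool" where
  "comodular E L X Y \<longleftrightarrow>
     X \<in> cocircuits L \<and> Y \<in> cocircuits L \<and> X \<noteq> Y \<and> X \<noteq> - Y \<and>
     modular_pair E L (zero_set E X) (zero_set E Y)"

text \<open>Cocircuit elimination of \<open>e\<close> between comodular \<open>X\<close> and \<open>Y\<close>. The conditions
  \<open>Z e = 0\<close> and \<open>supp Z \<subseteq> supp (sv_comp X Y) - {e}\<close> alone determine \<open>Z\<close> only up to sign;
  the sign is fixed by the usual requirement of the elimination axiom that the positive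
  (negative) part of \<open>Z\<close> is contained in the union of the positive (negative) parts of
  \<open>X\<close> and \<open>Y\<close>, that is, every nonzero entry of \<open>Z\<close> agrees with \<open>X\<close> or with \<open>Y\<close>.\<close>

definition cocircuit_elim ::
  "'a sign_vec set \<Rightarrow> 'a \<Rightarrow> 'a sign_vec \<Rightarrow> 'a sign_vec \<Rightarrow> 'a sign_vec" where
  "cocircuit_elim L e X Y = (THE Z. Z \<in> cocircuits L \<and> Z e = 0 \<and>
     supp Z \<subseteq> supp (sv_comp X Y) - {e} \<and>
     (\<forall>h\<in>supp Z. Z h = X h \<or> Z h = Y h))"

definition om_program :: "'a set \<Rightarrow> 'a sign_vec set \<Rightarrow> 'a \<Rightarrow> 'a \<Rightarrow> bool" where
  "om_program E L g f \<longleftrightarrow>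
     oriented_matroid E L \<and> g \<in> E \<and> f \<in> E \<and> g \<noteq> f \<and>
     \<not> mat_loop E L g \<and> \<not> mat_coloop E L f"

definition graph_verts :: "'a sign_vec set \<Rightarrow> 'a \<Rightarrow> 'a sign_vec set" where
  "graph_verts L g = {Y \<in> cocircuits L. Y g = 1}"

definition graph_adj ::
  "'a set \<Rightarrow> 'a sign_vec set \<Rightarrow> 'a \<Rightarrow> 'a sign_vec \<Rightarrow> 'a sign_vec \<Rightarrow> bool" where
  "graph_adj E L g X Y \<longleftrightarrow>
     X \<in> graph_verts L g \<and> Y \<in> graph_verts L g \<and> conformal X Y \<and> comodular E L X Y"

definition edge_fwd ::
  "'a sign_vec set \<Rightarrow> 'a \<Rightarrow> 'a \<Rightarrow> 'a sign_vec \<Rightarrow> 'a sign_vec \<Rightarrow> bool" where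
  "edge_fwd L g f X Y \<longleftrightarrow> cocircuit_elim L g (- X) Y f = 1"

definition edge_undirected ::
  "'a sign_vec set \<Rightarrow> 'a \<Rightarrow> 'a \<Rightarrow> 'a sign_vec \<Rightarrow> 'a sign_vec \<Rightarrow> bool" where
  "edge_undirected L g f X Y \<longleftrightarrow> cocircuit_elim L g (- X) Y f = 0"

definition directed_cycle ::
  "'a set \<Rightarrow> 'a sign_vec set \<Rightarrow> 'a \<Rightarrow> 'a \<Rightarrow> 'a sign_vec list \<Rightarrow> bool" where
  "directed_cycle E L g f Ps \<longleftrightarrow>
     Ps \<noteq> [] \<and> set Ps \<subseteq> graph_verts L g \<and> last Ps = hd Ps \<and> distinct (butlast Ps) \<and>
     (\<forall>i. Suc i < length Ps \<longrightarrow> graph_adj E L g (Ps ! i) (Ps ! Suc i) \<and>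
        (edge_fwd L g f (Ps ! i) (Ps ! Suc i) \<or> edge_undirected L g f (Ps ! i) (Ps ! Suc i))) \<and>
     \<not> (\<forall>i. Suc i < length Ps \<longrightarrow> edge_undirected L g f (Ps ! i) (Ps ! Suc i))"

definition euclidean_program :: "'a set \<Rightarrow> 'a sign_vec set \<Rightarrow> 'a \<Rightarrow> 'a \<Rightarrow> bool" where
  "euclidean_program E L g f \<longleftrightarrow>
     om_program E L g f \<and> (\<nexists>Ps. directed_cycle E L g f Ps)"

definition euclidean_om :: "'a set \<Rightarrow> 'a sign_vec set \<Rightarrow> bool" where
  "euclidean_om E L \<longleftrightarrow>
     oriented_matroid E L \<and>
     (\<forall>g f. om_program E L g f \<longrightarrow> euclidean_program E L g f)"

text \<open>\<open>(insert p E, L')\<close> is the single-element extension of \<open>(E, L)\<close> by \<open>p\<close> with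
  localization \<open>\<sigma>\<close>: deleting \<open>p\<close> gives \<open>(E, L)\<close>, and each cocircuit \<open>Y\<close> of \<open>(E, L)\<close>
  extends to the cocircuit \<open>(Y, \<sigma> Y)\<close>. As usual, extensions preserve the rank; without this
  requirement the localization \<open>\<sigma> = 0\<close> would not distinguish adding \<open>p\<close> as a loop from
  adding it as a coloop.\<close>

definition single_element_extension ::
  "'a set \<Rightarrow> 'a sign_vec set \<Rightarrow> 'a \<Rightarrow> ('a sign_vec \<Rightarrow> int) \<Rightarrow> 'a sign_vec set \<Rightarrow> bool" where
  "single_element_extension E L p \<sigma> L' \<longleftrightarrow>
     p \<notin> E \<and> oriented_matroid (insert p E) L' \<and>
     (\<lambda>X. X(p := 0)) ` L' = L \<and>
     mat_rank (insert p E) L' (insert p E) = mat_rank E L E \<and>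
     (\<forall>Y\<in>cocircuits L. Y(p := \<sigma> Y) \<in> cocircuits L')"

text \<open>A signed ordered subset is encoded as the list of the pairs \<open>(e\<^sub>i, \<alpha>\<^sub>i)\<close>.\<close>

fun lex_localization :: "('a \<times> int) list \<Rightarrow> 'a sign_vec \<Rightarrow> int" where
  "lex_localization [] Y = 0"
| "lex_localization ((e, \<alpha>) # I) Y = (if Y e \<noteq> 0 then \<alpha> * Y e else lex_localization I Y)"

definition lexicographic_extension ::
  "'a set \<Rightarrow> 'a sign_vec set \<Rightarrow> ('a \<times> int) list \<Rightarrow> 'a \<Rightarrow> 'a sign_vec set \<Rightarrow> bool" where
  "lexicographic_extension E L I p L' \<longleftrightarrow>
     distinct (map fst I) \<and> fst ` set I \<subseteq> E \<and> snd ` set I \<subseteq> {1, -1} \<and>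
     single_element_extension E L p (lex_localization I) L'"

end

theory Submission
  imports Defs "HOL-Library.Function_Algebras"
begin

text \<open>Let \<open>p\<close> extend a Euclidean oriented matroid by the list \<open>[e\<^sub>1, \<dots>, e\<^sub>k]\<close>, and suppose the graph
  of the program \<open>(p, f)\<close> has a directed cycle. Signs of \<open>f\<close> never decrease along edges, so \<open>f\<close> has a
  constant sign \<open>c\<close> on the cycle, and \<open>c = 0\<close> would make all edges undirected. Let \<open>e\<close> be the first
  list element that does not vanish on the whole cycle. All edges between \<open>e = 0\<close> and \<open>e \<noteq> 0\<close> are
  directed the same way, which is determined by \<open>c\<close>, so \<open>e\<close> vanishes nowhere on the cycle, which
  therefore is a closed walk in the graphs of all programs with \<open>e\<close> at infinity. On the line through
  an edge, which is an oriented matroid of rank two, \<open>p\<close> is infinitesimally close to \<open>e\<close>. Compare the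
  points \<open>Z\<close> and \<open>Z\<^sub>0\<close> of this line with \<open>Z p = 0\<close> and \<open>Z\<^sub>0 e = 0\<close>: if \<open>Z\<^sub>0 f \<noteq> 0\<close> then \<open>Z f = Z\<^sub>0 f\<close>, so
  Euclideanness of \<open>(e, f)\<close> forces \<open>Z\<^sub>0 f = 0\<close> on all edges. Then \<open>f\<close> is parallel to \<open>e\<close> on the line,
  which gives \<open>Z f = - c * \<sigma> Z\<^sub>0\<close>. Since no \<open>Z f\<close> is negative, Euclideanness of \<open>(e, d)\<close> for the list
  elements \<open>d\<close>, taken in order, shows that they all vanish on every \<open>Z\<^sub>0\<close>; hence \<open>\<sigma> Z\<^sub>0 = 0\<close> and all
  edges are undirected.\<close>

section \<open>Covectors, contractions and rank\<close>

lemma supp_uminus [simp]: "supp (- X) = supp X"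
  by (simp add: supp_def)

lemma zero_set_uminus [simp]: "zero_set E (- X) = zero_set E X"
  by (simp add: zero_set_def)

lemma sep_commute: "sep Y X = sep X Y"
  by (auto simp: sep_def)

lemma sep_uminus_uminus [simp]: "sep (- X) (- Y) = sep X Y"
  by (auto simp: sep_def)

lemma mem_sep_uminus_iff: "h \<in> sep (- X) Y \<longleftrightarrow> X h = Y h \<and> X h \<noteq> 0"
  by (auto simp: sep_def)

text \<open>The elements of \<open>A\<close> are not removed from the ground set but become loops.\<close>

definition contraction :: "'a sign_vec set \<Rightarrow> 'a set \<Rightarrow> 'a sign_vec set" where
  "contraction L A = {V \<in> L. \<forall>a\<in>A. V a = 0}"

lemma contraction_antimono: "A \<subseteq> B \<Longrightarrow> contraction L B \<subseteq> contraction L A"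
  by (auto simp: contraction_def)

lemma contraction_contraction: "contraction (contraction L A) B = contraction L (A \<union> B)"
  by (auto simp: contraction_def)

definition spanning :: "'a sign_vec set \<Rightarrow> 'a set \<Rightarrow> bool" where
  "spanning L S \<longleftrightarrow> contraction L S \<subseteq> {\<lambda>_. 0}"

lemma cocircuits_contraction_subset: "cocircuits (contraction L A) \<subseteq> cocircuits L"
proof
  fix X assume X: "X \<in> cocircuits (contraction L A)"
  have "Y = X" if Y: "Y \<in> L" "Y \<noteq> (\<lambda>_. 0)" "face_le Y X" for Y
  proof -
    have "Y \<in> contraction L A"
      using X Y(1,3) by (auto simp: cocircuits_def contraction_def face_le_def)
    then show ?thesis using X Y(2,3) by (simp add: cocircuits_def)
  qed
  then show "X \<in> cocircuits L" using X by (simp add: cocircuits_def contraction_def)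
qed

locale oriented_matroid_covectors =
  fixes E :: "'a set" and L :: "'a sign_vec set"
  assumes oriented_matroid: "oriented_matroid E L"
begin

lemma finite_ground: "finite E"
  and uminus_covector: "X \<in> L \<Longrightarrow> - X \<in> L"
  and covector_sign_vectors: "X \<in> L \<Longrightarrow> X \<in> sign_vectors E"
  using oriented_matroid by (simp_all add: oriented_matroid_def subset_iff)

lemma covector_sign: "X \<in> L \<Longrightarrow> X h = -1 \<or> X h = 0 \<or> X h = 1"
  by (drule covector_sign_vectors) (auto simp: sign_vectors_def)

lemma covector_outside: "X \<in> L \<Longrightarrow> h \<notin> E \<Longrightarrow> X h = 0"
  by (drule covector_sign_vectors) (simp add: sign_vectors_def)

lemma covector_equal_or_opposite:
  assumes "X \<in> L" "Y \<in> L" "X h \<noteq> 0" "Y h \<noteq> 0"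
  shows "X h = Y h \<or> X h = - Y h"
  using covector_sign[OF assms(1), of h] covector_sign[OF assms(2), of h] assms by auto

lemma covector_elimination:
  assumes X: "X \<in> L" and Y: "Y \<in> L" and e: "e \<in> sep X Y"
  obtains Z where "Z \<in> L" "Z e = 0" "\<And>h. h \<notin> sep X Y \<Longrightarrow> Z h = sv_comp X Y h"
proof -
  obtain Z where Z: "Z \<in> L" "Z e = 0" "\<forall>h\<in>E - sep X Y. Z h = sv_comp X Y h"
    using oriented_matroid assms by (simp add: oriented_matroid_def) blast
  have "Z h = sv_comp X Y h" if "h \<notin> sep X Y" for h
    using Z(3) that covector_outside[OF X] covector_outside[OF Y] covector_outside[OF Z(1)]
    by (cases "h \<in> E") (simp_all add: sv_comp_def)
  with Z that show thesis by blast
qed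

lemma covector_difference:
  assumes "X \<in> L" "Y \<in> L" "X e = Y e" "X e \<noteq> 0"
  obtains Z where "Z \<in> L" "Z e = 0"
    "\<And>h. X h \<noteq> Y h \<or> X h = 0 \<Longrightarrow> Z h = sv_comp (- X) Y h"
  using covector_elimination[of "- X" Y e] assms uminus_covector
  by (metis mem_sep_uminus_iff)

lemma elimination_signs:
  assumes XY: "X \<in> L" "Y \<in> L"
    and Z: "Z \<in> L" "Z e = 0" "\<And>h. h \<notin> sep X Y \<Longrightarrow> Z h = sv_comp X Y h"
  shows "supp Z \<subseteq> supp (sv_comp X Y) - {e}"
    and "h \<in> supp Z \<Longrightarrow> Z h = X h \<or> Z h = Y h"
proof -
  show "supp Z \<subseteq> supp (sv_comp X Y) - {e}"
  proof
    fix h assume "h \<in> supp Z"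
    then show "h \<in> supp (sv_comp X Y) - {e}"
      using Z(2) Z(3)[of h] by (cases "h \<in> sep X Y") (auto simp: supp_def sep_def sv_comp_def)
  qed
  show "Z h = X h \<or> Z h = Y h" if "h \<in> supp Z"
    using that Z(3)[of h] covector_equal_or_opposite[OF Z(1) XY(1), of h]
    by (cases "h \<in> sep X Y") (auto simp: supp_def sep_def sv_comp_def split: if_splits)
qed

lemma oriented_matroid_contraction: "oriented_matroid E (contraction L A)"
proof -
  have "\<exists>Z\<in>contraction L A. Z e = 0 \<and> (\<forall>h\<in>E - sep X Y. Z h = sv_comp X Y h)"
    if XY: "X \<in> contraction L A" "Y \<in> contraction L A" and e: "e \<in> sep X Y" for X Y e
  proof -
    obtain Z where Z: "Z \<in> L" "Z e = 0" "\<And>h. h \<notin> sep X Y \<Longrightarrow> Z h = sv_comp X Y h"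
      using covector_elimination XY e unfolding contraction_def by blast
    then have "Z \<in> contraction L A"
      using XY by (simp add: contraction_def sep_def sv_comp_def)
    with Z show ?thesis by blast
  qed
  then show ?thesis
    using oriented_matroid by (auto simp: oriented_matroid_def contraction_def sv_comp_def)
qed

lemma notin_closure_iff:
  assumes "A \<subseteq> E" "e \<in> E"
  shows "e \<notin> mat_closure E L A \<longleftrightarrow> (\<exists>V\<in>contraction L A. V e \<noteq> 0)"
proof -
  have "A \<subseteq> zero_set E V \<longleftrightarrow> (\<forall>a\<in>A. V a = 0)" "e \<notin> zero_set E V \<longleftrightarrow> V e \<noteq> 0" for V
    using assms by (auto simp: zero_set_def supp_def)
  then show ?thesis by (auto simp: mat_closure_def flats_def contraction_def)
qed

lemma indep_iff:
  "mat_indep E L A \<longleftrightarrow> A \<subseteq> E \<and> (\<forall>e\<in>A. \<exists>V\<in>contraction L (A - {e}). V e \<noteq> 0)"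
proof -
  have "e \<notin> mat_closure E L (A - {e}) \<longleftrightarrow> (\<exists>V\<in>contraction L (A - {e}). V e \<noteq> 0)"
    if "A \<subseteq> E" "e \<in> A" for e
    using that by (intro notin_closure_iff) auto
  then show ?thesis unfolding mat_indep_def by blast
qed

lemma indep_empty: "mat_indep E L {}"
  by (simp add: indep_iff)

lemma indep_finite: "mat_indep E L A \<Longrightarrow> finite A"
  using finite_ground finite_subset by (auto simp: indep_iff)

lemma indep_subset:
  assumes A: "mat_indep E L A" and "B \<subseteq> A"
  shows "mat_indep E L B"
  unfolding indep_iff
proof (intro conjI ballI)
  show "B \<subseteq> E" using assms by (auto simp: indep_iff)
  fix e assume "e \<in> B"
  then obtain V where "V \<in> contraction L (A - {e})" "V e \<noteq> 0"
    using assms unfolding indep_iff by blast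
  moreover have "contraction L (A - {e}) \<subseteq> contraction L (B - {e})"
    using \<open>B \<subseteq> A\<close> by (rule contraction_antimono[OF Diff_mono[OF _ subset_refl]])
  ultimately show "\<exists>V\<in>contraction L (B - {e}). V e \<noteq> 0" by blast
qed

lemma indep_insert:
  assumes A: "mat_indep E L A" and V: "V \<in> contraction L A" "V e \<noteq> 0"
  shows "mat_indep E L (insert e A)"
  unfolding indep_iff
proof (intro conjI ballI)
  show "insert e A \<subseteq> E"
    using A V covector_outside by (auto simp: indep_iff contraction_def)
  fix b assume b: "b \<in> insert e A"
  show "\<exists>U\<in>contraction L (insert e A - {b}). U b \<noteq> 0"
  proof (cases "b = e")
    case True
    then show ?thesis using V by (auto simp: contraction_def)
  next
    case False
    then have bA: "b \<in> A" using b by simp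
    then obtain W where W: "W \<in> contraction L (A - {b})" "W b \<noteq> 0"
      using A unfolding indep_iff by blast
    show ?thesis
    proof (cases "W e = 0")
      case True
      then show ?thesis using W by (auto simp: contraction_def)
    next
      case nz: False
      have VL: "V \<in> L" and WL: "W \<in> L" using V W by (simp_all add: contraction_def)
      have "- V \<in> contraction L A" using V uminus_covector by (simp add: contraction_def)
      moreover have "V e = W e \<or> (- V) e = W e"
        using covector_equal_or_opposite[OF VL WL V(2) nz] by auto
      ultimately obtain V' where V': "V' \<in> contraction L A" "V' e = W e" using V(1) by blast
      then obtain U where U: "U \<in> L" "U e = 0"
        "\<And>h. V' h \<noteq> W h \<or> V' h = 0 \<Longrightarrow> U h = sv_comp (- V') W h"
        using covector_difference[of V' W e] W nz by (auto simp: contraction_def)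
      then have "U \<in> contraction L (insert e A - {b})" "U b \<noteq> 0"
        using V' W bA by (auto simp: contraction_def sv_comp_def)
      then show ?thesis by blast
    qed
  qed
qed

lemma card_indep_le_card_spanning:
  assumes "mat_indep E L B" "finite S" "spanning L S"
  shows "card B \<le> card S"
  using assms(1)
proof (induction "card (B - S)" arbitrary: B rule: less_induct)
  case less
  show ?case
  proof (cases "B \<subseteq> S")
    case True
    then show ?thesis using assms(2) by (rule card_mono[rotated])
  next
    case False
    then obtain b where b: "b \<in> B" "b \<notin> S" by blast
    then obtain V where V: "V \<in> contraction L (B - {b})" "V b \<noteq> 0"
      using less.prems unfolding indep_iff by blast
    then have "V \<notin> contraction L S" using assms(3) by (auto simp: spanning_def)
    then obtain s where s: "s \<in> S" "V s \<noteq> 0" using V by (auto simp: contraction_def)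
    let ?B = "insert s (B - {b})"
    have finB: "finite B" using less.prems by (rule indep_finite)
    have "mat_indep E L ?B"
      using indep_insert[OF indep_subset[OF less.prems] V(1) s(2)] by blast
    moreover have "?B - S \<subset> B - S" using s b by auto
    then have "card (?B - S) < card (B - S)" using finB by (simp add: psubset_card_mono)
    ultimately have "card ?B \<le> card S" using less.hyps by blast
    moreover have "s \<notin> B - {b}" using V(1) s(2) by (auto simp: contraction_def)
    then have "card ?B = card B"
      using finB b(1) by (simp add: card.remove[of B b] del: card_Diff_insert)
    ultimately show ?thesis by simp
  qed
qed

lemma finite_indep_subsets: "finite {B. B \<subseteq> A \<and> mat_indep E L B}"
  using finite_ground by (auto simp: indep_iff intro: finite_subset[of _ "Pow E"])

lemma card_indep_le_rank: "B \<subseteq> A \<Longrightarrow> mat_indep E L B \<Longrightarrow> card B \<le> mat_rank E L A"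
  unfolding mat_rank_def using finite_indep_subsets by (intro Max_ge) auto

lemma rank_attained:
  obtains B where "B \<subseteq> A" "mat_indep E L B" "card B = mat_rank E L A"
proof -
  have "mat_rank E L A \<in> card ` {B. B \<subseteq> A \<and> mat_indep E L B}"
    unfolding mat_rank_def using finite_indep_subsets indep_empty by (intro Max_in) auto
  then show thesis using that by auto
qed

lemma rank_mono: "A \<subseteq> B \<Longrightarrow> mat_rank E L A \<le> mat_rank E L B"
  by (rule rank_attained[of A]) (metis card_indep_le_rank order_trans)

lemma contraction_maximal_indep:
  assumes A: "A \<subseteq> S" "mat_indep E L A" "card A = mat_rank E L S"
  shows "contraction L A = contraction L S"
proof (intro equalityI subsetI)
  fix V assume V: "V \<in> contraction L A"
  have "V h = 0" if h: "h \<in> S" for h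
  proof (rule ccontr)
    assume nz: "V h \<noteq> 0"
    then have "mat_indep E L (insert h A)" by (rule indep_insert[OF A(2) V])
    then have "card (insert h A) \<le> mat_rank E L S" using A(1) h by (intro card_indep_le_rank) auto
    moreover have "h \<notin> A" using V nz by (auto simp: contraction_def)
    ultimately show False using A(3) indep_finite[OF A(2)] by simp
  qed
  then show "V \<in> contraction L S" using V by (simp add: contraction_def)
qed (use contraction_antimono[OF A(1)] in blast)

lemma indep_Un_contraction:
  assumes A: "A \<subseteq> F" "mat_indep E L A" and C: "mat_indep E (contraction L F) C"
  shows "mat_indep E L (A \<union> C)" "A \<inter> C = {}"
proof -
  interpret contracted: oriented_matroid_covectors E "contraction L F"
    by unfold_locales (rule oriented_matroid_contraction)
  have ex: "\<exists>V\<in>contraction L (A \<union> (D - {c})). V c \<noteq> 0 \<and> c \<notin> A" if "c \<in> D" "D \<subseteq> C" for c D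
  proof -
    obtain V where V: "V \<in> contraction L (F \<union> (D - {c}))" "V c \<noteq> 0"
      using contracted.indep_subset[OF C \<open>D \<subseteq> C\<close>] \<open>c \<in> D\<close>
      unfolding contracted.indep_iff contraction_contraction by blast
    then have "V \<in> contraction L (A \<union> (D - {c}))" "c \<notin> A"
      using A(1) by (auto simp: contraction_def)
    then show ?thesis using V(2) by blast
  qed
  show "A \<inter> C = {}" using ex[of _ C] by blast
  have "mat_indep E L (A \<union> D)" if "D \<subseteq> C" for D
    using finite_subset[OF that contracted.indep_finite[OF C]] that
  proof (induction D rule: finite_induct)
    case (insert c D)
    then show ?case using ex[of c "insert c D"] indep_insert[of "A \<union> D"] by auto
  qed (use A in simp)
  then show "mat_indep E L (A \<union> C)" by simp
qed

lemma rank_contraction_le: "mat_rank E (contraction L F) E + mat_rank E L F \<le> mat_rank E L E"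
proof -
  interpret contracted: oriented_matroid_covectors E "contraction L F"
    by unfold_locales (rule oriented_matroid_contraction)
  obtain A where A: "A \<subseteq> F" "mat_indep E L A" "card A = mat_rank E L F" by (rule rank_attained)
  obtain C where C: "mat_indep E (contraction L F) C" "card C = mat_rank E (contraction L F) E"
    by (rule contracted.rank_attained)
  have "card (A \<union> C) = card A + card C"
    by (rule card_Un_disjoint[OF indep_finite[OF A(2)] contracted.indep_finite[OF C(1)]
          indep_Un_contraction(2)[OF A(1,2) C(1)]])
  moreover have "card (A \<union> C) \<le> mat_rank E L E"
    using indep_Un_contraction(1)[OF A(1,2) C(1)]
    by (intro card_indep_le_rank) (auto simp: indep_iff)
  ultimately show ?thesis using A(3) C(2) by simp
qed

section \<open>Cocircuits\<close>

lemma uminus_cocircuit: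
  assumes X: "X \<in> cocircuits L"
  shows "- X \<in> cocircuits L"
proof -
  have "Y = - X" if Y: "Y \<in> L" "Y \<noteq> (\<lambda>_. 0)" "face_le Y (- X)" for Y
  proof -
    have "face_le (- Y) X" using Y(3) by (auto simp: face_le_def)
    moreover have "- Y \<noteq> (\<lambda>_. 0)" using Y(2) by (simp add: fun_eq_iff)
    ultimately have "- Y = X" using X uminus_covector[OF Y(1)] by (simp add: cocircuits_def)
    then show ?thesis by (metis minus_minus)
  qed
  moreover have "- X \<noteq> (\<lambda>_. 0)" using X by (simp add: cocircuits_def fun_eq_iff)
  ultimately show ?thesis using X uminus_covector by (simp add: cocircuits_def)
qed

text \<open>Cocircuits are defined as minimal for the face order; a covector of smaller support can be
  moved towards \<open>X\<close> by elimination until it becomes a face of \<open>X\<close>.\<close>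

lemma cocircuit_support_minimal:
  assumes X: "X \<in> cocircuits L" and V: "V \<in> L" "supp V \<subset> supp X"
  shows "V = (\<lambda>_. 0)"
  using V
proof (induction "card (sep X V)" arbitrary: V rule: less_induct)
  case less
  have XL: "X \<in> L" using X by (simp add: cocircuits_def)
  show ?case
  proof (cases "sep X V = {}")
    case True
    have "V h = 0 \<or> V h = X h" for h
      using True less.prems(2) covector_equal_or_opposite[OF XL less.prems(1), of h]
      by (auto simp: sep_def supp_def)
    then have "face_le V X" by (simp add: face_le_def)
    then show ?thesis using X less.prems by (auto simp: cocircuits_def)
  next
    case False
    then obtain h where h: "h \<in> sep X V" by blast
    then obtain Z where Z: "Z \<in> L" "Z h = 0" "\<And>k. k \<notin> sep X V \<Longrightarrow> Z k = sv_comp X V k"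
      using covector_elimination[OF XL less.prems(1)] by blast
    obtain k where k: "X k \<noteq> 0" "V k = 0" using less.prems(2) by (auto simp: supp_def)
    have off_support: "Z a = 0" if "X a = 0" for a
      using Z(3)[of a] that less.prems(2) by (auto simp: supp_def sep_def sv_comp_def)
    have "X h \<noteq> 0" using h by (simp add: sep_def)
    then have "supp Z \<subset> supp X" using off_support Z(2) by (auto simp: supp_def)
    moreover have "sep X Z \<subset> sep X V"
    proof -
      have "a \<in> sep X V" if "a \<in> sep X Z" for a
        using that Z(3)[of a] by (cases "a \<in> sep X V") (auto simp: sep_def sv_comp_def)
      moreover have "h \<notin> sep X Z" using Z(2) by (simp add: sep_def)
      ultimately show ?thesis using h by blast
    qed
    moreover have "finite (sep X V)"
      using covector_outside[OF XL] by (intro finite_subset[OF _ finite_ground]) (auto simp: sep_def)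
    ultimately have "Z = (\<lambda>_. 0)" using less.hyps Z(1) by (simp add: psubset_card_mono)
    then show ?thesis using Z(3)[of k] k by (simp add: sep_def sv_comp_def)
  qed
qed

lemma cocircuit_basis:
  assumes X: "X \<in> cocircuits L" and e: "X e \<noteq> 0"
  obtains A where "A \<subseteq> zero_set E X" "card A = mat_rank E L (zero_set E X)"
    "mat_indep E L (insert e A)" "spanning L (insert e A)"
proof -
  have XL: "X \<in> L" using X by (simp add: cocircuits_def)
  obtain A where A: "A \<subseteq> zero_set E X" "mat_indep E L A" "card A = mat_rank E L (zero_set E X)"
    by (rule rank_attained)
  have "X \<in> contraction L A" using A(1) XL by (auto simp: contraction_def zero_set_def supp_def)
  then have indep: "mat_indep E L (insert e A)" using e by (rule indep_insert[OF A(2)])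
  have "V = (\<lambda>_. 0)" if V: "V \<in> contraction L (insert e A)" for V
  proof (rule cocircuit_support_minimal[OF X])
    show VL: "V \<in> L" using V by (simp add: contraction_def)
    have "V \<in> contraction L (zero_set E X)"
      using V contraction_maximal_indep[OF A] by (auto simp: contraction_def)
    then have "supp V \<subseteq> supp X"
      using covector_outside[OF VL] by (auto simp: contraction_def zero_set_def supp_def)
    moreover have "V e = 0" using V by (simp add: contraction_def)
    ultimately show "supp V \<subset> supp X" using e by (auto simp: supp_def)
  qed
  then have "spanning L (insert e A)" by (auto simp: spanning_def)
  then show thesis using that A indep by blast
qed

lemma rank_le_Suc_rank_zero_set:
  assumes X: "X \<in> cocircuits L"
  shows "mat_rank E L E \<le> Suc (mat_rank E L (zero_set E X))"
proof -
  obtain e where "X e \<noteq> 0" using X by (auto simp: cocircuits_def)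
  then obtain A where A: "card A = mat_rank E L (zero_set E X)" "mat_indep E L (insert e A)"
    "spanning L (insert e A)"
    using cocircuit_basis[OF X] by metis
  have finA: "finite A" using indep_finite[OF A(2)] by simp
  obtain B where B: "mat_indep E L B" "card B = mat_rank E L E" by (rule rank_attained)
  have "card B \<le> card (insert e A)"
    using finA by (intro card_indep_le_card_spanning[OF B(1) _ A(3)]) simp
  also have "\<dots> \<le> Suc (card A)" using finA by (simp add: card_insert_if)
  finally show ?thesis unfolding A(1) B(2) .
qed

lemma indep_spanning_imp_basis:
  assumes B: "mat_indep E L B" "spanning L B"
  shows "mat_basis E L B"
  unfolding mat_basis_def
proof (intro conjI allI impI)
  fix C assume C: "mat_indep E L C \<and> B \<subseteq> C"
  have "c \<in> B" if c: "c \<in> C" for c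
  proof (rule ccontr)
    assume "c \<notin> B"
    then obtain V where "V \<in> contraction L B" "V c \<noteq> 0"
      using C c unfolding indep_iff contraction_def by blast
    then show False using B(2) by (auto simp: spanning_def)
  qed
  then show "C = B" using C by blast
qed (rule B(1))

lemma coloop_zero_on_cocircuit:
  assumes f: "mat_coloop E L f" and X: "X \<in> cocircuits L" and e: "X e \<noteq> 0" "f \<noteq> e"
  shows "X f = 0"
proof -
  obtain A where A: "A \<subseteq> zero_set E X" "mat_indep E L (insert e A)" "spanning L (insert e A)"
    using cocircuit_basis[OF X e(1)] by metis
  then have "f \<in> insert e A" using f indep_spanning_imp_basis unfolding mat_coloop_def by blast
  then show ?thesis using e A(1) by (auto simp: zero_set_def supp_def)
qed

end

section \<open>Rank two and cocircuit elimination\<close>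

text \<open>In rank two the cocircuits are the nonzero covectors that vanish at some element \<open>g\<close> that is
  not a loop; below, a covector \<open>U\<close> with \<open>U g \<noteq> 0\<close> witnesses the latter.\<close>

locale rank_two_oriented_matroid = oriented_matroid_covectors +
  assumes rank_le_two: "mat_rank E L E \<le> 2"
begin

lemma zero_at_two_elements:
  assumes U: "U \<in> L" "U g \<noteq> 0" and V: "V \<in> L" "V g = 0" "V a \<noteq> 0"
    and W: "W \<in> L" "W g = 0" "W a = 0"
  shows "W = (\<lambda>_. 0)"
proof (rule ccontr)
  assume "W \<noteq> (\<lambda>_. 0)"
  then obtain b where b: "W b \<noteq> 0" by auto
  have "mat_indep E L {g}"
    using U by (intro indep_insert[OF indep_empty]) (simp_all add: contraction_def)
  then have "mat_indep E L {a, g}"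
    using V by (intro indep_insert[of "{g}" V]) (simp_all add: contraction_def)
  then have indep: "mat_indep E L {b, a, g}"
    using W b by (intro indep_insert[of "{a, g}" W]) (simp_all add: contraction_def)
  have "card {b, a, g} \<le> mat_rank E L E"
    using indep by (intro card_indep_le_rank) (simp_all add: mat_indep_def)
  moreover have "card {b, a, g} = 3" using V W b by (auto simp: card_insert_if)
  ultimately show False using rank_le_two by simp
qed

lemma eq_of_common_sign:
  assumes U: "U \<in> L" "U g \<noteq> 0" and V: "V \<in> L" "V g = 0" and W: "W \<in> L" "W g = 0"
    and a: "V a = W a" "V a \<noteq> 0"
  shows "V = W"
proof -
  obtain Z where Z: "Z \<in> L" "Z a = 0" "\<And>h. V h \<noteq> W h \<or> V h = 0 \<Longrightarrow> Z h = sv_comp (- V) W h"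
    using covector_difference[OF V(1) W(1) a] by blast
  then have "Z g = 0" using V(2) W(2) by (simp add: sv_comp_def)
  then have "Z = (\<lambda>_. 0)" using zero_at_two_elements[OF U V a(2) Z(1) _ Z(2)] by blast
  then have "V h = W h" for h
    using Z(3)[of h] \<open>Z = (\<lambda>_. 0)\<close> by (cases "V h = W h") (auto simp: sv_comp_def split: if_splits)
  then show ?thesis by blast
qed

lemma cocircuitI:
  assumes U: "U \<in> L" "U g \<noteq> 0" and V: "V \<in> L" "V g = 0" "V \<noteq> (\<lambda>_. 0)"
  shows "V \<in> cocircuits L"
proof -
  have "W = V" if W: "W \<in> L" "W \<noteq> (\<lambda>_. 0)" "face_le W V" for W
  proof -
    obtain a where a: "W a \<noteq> 0" using W(2) by auto
    have "W g = 0" "W a = V a" using W(3) V(2) a by (auto simp: face_le_def)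
    then show ?thesis by (rule eq_of_common_sign[OF U W(1) _ V(1,2) _ a])
  qed
  then show ?thesis using V by (simp add: cocircuits_def)
qed

text \<open>The element \<open>f\<close> is parallel to \<open>g\<close> or a loop, because \<open>Z\<close> vanishes at both.\<close>

lemma parallel_values:
  assumes Z: "Z \<in> L" "Z \<noteq> (\<lambda>_. 0)" "Z g = 0" "Z f = 0"
    and VW: "V \<in> L" "W \<in> L" "V g = W g" "V g \<noteq> 0"
  shows "V f = W f"
proof (rule ccontr)
  assume ne: "V f \<noteq> W f"
  obtain U where U: "U \<in> L" "U g = 0" "\<And>h. V h \<noteq> W h \<or> V h = 0 \<Longrightarrow> U h = sv_comp (- V) W h"
    using covector_difference[OF VW] by blast
  have "U f \<noteq> 0" using U(3)[of f] ne by (auto simp: sv_comp_def)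
  then show False using zero_at_two_elements[OF VW(1,4) U(1,2) _ Z(1,3,4)] Z(2) by blast
qed

end

lemma comodular_commute: "comodular E L X Y \<Longrightarrow> comodular E L Y X"
  unfolding comodular_def modular_pair_def
  by (metis Int_commute Un_commute add.commute minus_minus)

definition line_covectors :: "'a set \<Rightarrow> 'a sign_vec set \<Rightarrow> 'a sign_vec \<Rightarrow> 'a sign_vec \<Rightarrow> 'a sign_vec set"
  where "line_covectors E L X Y = contraction L (zero_set E X \<inter> zero_set E Y)"

text \<open>With \<open>g\<close> at infinity, this is the point at infinity of the line through \<open>X\<close> and \<open>Y\<close>; its sign
  at \<open>f\<close> directs the edge.\<close>

definition edge_direction ::
  "'a sign_vec set \<Rightarrow> 'a \<Rightarrow> 'a sign_vec \<Rightarrow> 'a sign_vec \<Rightarrow> 'a sign_vec" where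
  "edge_direction L g X Y = cocircuit_elim L g (- X) Y"

lemma cocircuit_elim_commute: "cocircuit_elim L e X Y = cocircuit_elim L e Y X"
proof -
  have "supp (sv_comp X Y) = supp (sv_comp Y X)" by (auto simp: supp_def sv_comp_def)
  then show ?thesis unfolding cocircuit_elim_def by (metis (no_types, lifting))
qed

context oriented_matroid_covectors
begin

lemma comodular_covectors:
  assumes "comodular E L X Y"
  shows "X \<in> L" "Y \<in> L"
  using assms by (auto simp: comodular_def cocircuits_def)

lemma comodular_uminus_left:
  assumes "comodular E L X Y"
  shows "comodular E L (- X) Y"
  using assms uminus_cocircuit unfolding comodular_def by (metis minus_minus zero_set_uminus)

lemma comodular_uminus:
  assumes "comodular E L X Y"
  shows "comodular E L (- X) (- Y)"
  by (intro comodular_uminus_left comodular_commute[OF comodular_uminus_left]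
      comodular_commute[OF assms])

lemma mem_line_covectors_iff:
  assumes "X \<in> L" "Y \<in> L"
  shows "V \<in> line_covectors E L X Y \<longleftrightarrow> V \<in> L \<and> (\<forall>h. X h = 0 \<and> Y h = 0 \<longrightarrow> V h = 0)"
  using covector_outside by (auto simp: line_covectors_def contraction_def zero_set_def supp_def)

lemma rank_two_line:
  assumes XY: "comodular E L X Y"
  shows "rank_two_oriented_matroid E (line_covectors E L X Y)"
proof -
  let ?F = "zero_set E X \<inter> zero_set E Y"
  let ?r = "mat_rank E L"
  have "?r (zero_set E X) + ?r (zero_set E Y) = ?r (zero_set E X \<union> zero_set E Y) + ?r ?F"
    using XY by (simp add: comodular_def modular_pair_def)
  moreover have "?r (zero_set E X \<union> zero_set E Y) \<le> ?r E"
    by (intro rank_mono) (auto simp: zero_set_def)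
  moreover have "?r E \<le> Suc (?r (zero_set E X))" "?r E \<le> Suc (?r (zero_set E Y))"
    using XY by (auto simp: comodular_def intro: rank_le_Suc_rank_zero_set)
  ultimately have "?r E \<le> ?r ?F + 2" by linarith
  then have "mat_rank E (contraction L ?F) E \<le> 2" using rank_contraction_le[of ?F] by linarith
  then show ?thesis
    unfolding line_covectors_def by unfold_locales (rule oriented_matroid_contraction)
qed

lemma line_cocircuit:
  assumes XY: "comodular E L X Y" and U: "U \<in> line_covectors E L X Y" "U g \<noteq> 0"
    and V: "V \<in> line_covectors E L X Y" "V g = 0" "V \<noteq> (\<lambda>_. 0)"
  shows "V \<in> cocircuits L"
proof -
  interpret line: rank_two_oriented_matroid E "line_covectors E L X Y" by (rule rank_two_line[OF XY])
  show ?thesis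
    using line.cocircuitI[OF U V] cocircuits_contraction_subset
    unfolding line_covectors_def by blast
qed

lemma cocircuit_elim_eqI:
  assumes XY: "comodular E L X Y" and e: "e \<in> sep X Y"
    and Z: "Z \<in> L" "Z e = 0" "\<And>h. h \<notin> sep X Y \<Longrightarrow> Z h = sv_comp X Y h"
  shows "cocircuit_elim L e X Y = Z"
  unfolding cocircuit_elim_def
proof (rule the_equality)
  let ?K = "line_covectors E L X Y"
  interpret line: rank_two_oriented_matroid E ?K by (rule rank_two_line[OF XY])
  note cov = comodular_covectors[OF XY]
  note mem = mem_line_covectors_iff[OF cov]
  have XK: "X \<in> ?K" "X e \<noteq> 0" using cov e by (simp_all add: mem sep_def)
  have ZK: "Z \<in> ?K" using Z by (simp add: mem sep_def sv_comp_def)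
  obtain k where k: "X k \<noteq> - Y k" using XY by (auto simp: comodular_def fun_eq_iff)
  then have Zk: "Z k = sv_comp X Y k" "Z k \<noteq> 0"
    using Z(3)[of k] by (auto simp: sep_def sv_comp_def)
  have "Z \<in> cocircuits L"
    using Zk(2) by (intro line_cocircuit[OF XY XK ZK Z(2)]) auto
  then show "Z \<in> cocircuits L \<and> Z e = 0 \<and> supp Z \<subseteq> supp (sv_comp X Y) - {e} \<and>
     (\<forall>h\<in>supp Z. Z h = X h \<or> Z h = Y h)"
    using elimination_signs[OF cov Z] Z(2) by blast
  fix V assume V: "V \<in> cocircuits L \<and> V e = 0 \<and> supp V \<subseteq> supp (sv_comp X Y) - {e} \<and>
     (\<forall>h\<in>supp V. V h = X h \<or> V h = Y h)"
  have Ve: "V e = 0" using V by blast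
  have VK: "V \<in> ?K" using V by (auto simp: mem cocircuits_def supp_def sv_comp_def)
  have Vk: "V k \<noteq> 0"
    using line.zero_at_two_elements[OF XK ZK Z(2) Zk(2) VK Ve] V by (auto simp: cocircuits_def)
  have "V k = X k \<or> V k = Y k" using Vk V by (auto simp: supp_def)
  then have "V k = Z k"
    using k Vk Zk covector_equal_or_opposite[OF cov, of k]
    by (auto simp: sv_comp_def split: if_splits)
  then show "V = Z" by (rule line.eq_of_common_sign[OF XK VK Ve ZK Z(2) _ Vk])
qed

lemma cocircuit_elim_covector:
  assumes XY: "comodular E L X Y" and e: "e \<in> sep X Y"
  shows "cocircuit_elim L e X Y \<in> L" "cocircuit_elim L e X Y e = 0"
    "h \<notin> sep X Y \<Longrightarrow> cocircuit_elim L e X Y h = sv_comp X Y h"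
proof -
  obtain Z where Z: "Z \<in> L" "Z e = 0" "\<And>h. h \<notin> sep X Y \<Longrightarrow> Z h = sv_comp X Y h"
    using covector_elimination[OF comodular_covectors[OF XY] e] by blast
  have eq: "cocircuit_elim L e X Y = Z" by (rule cocircuit_elim_eqI[OF XY e Z])
  show "cocircuit_elim L e X Y \<in> L" "cocircuit_elim L e X Y e = 0"
    "h \<notin> sep X Y \<Longrightarrow> cocircuit_elim L e X Y h = sv_comp X Y h"
    unfolding eq by (fact Z)+
qed

lemma cocircuit_elim_uminus:
  assumes XY: "comodular E L X Y" and e: "e \<in> sep X Y"
  shows "cocircuit_elim L e (- X) (- Y) = - cocircuit_elim L e X Y"
proof (rule cocircuit_elim_eqI)
  note elim = cocircuit_elim_covector[OF XY e]
  show "comodular E L (- X) (- Y)" "e \<in> sep (- X) (- Y)"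
    using comodular_uminus[OF XY] e by simp_all
  show "- cocircuit_elim L e X Y \<in> L" "(- cocircuit_elim L e X Y) e = 0"
    using elim(1,2) uminus_covector by simp_all
  show "(- cocircuit_elim L e X Y) h = sv_comp (- X) (- Y) h" if "h \<notin> sep (- X) (- Y)" for h
    using elim(3)[of h] that by (simp add: sv_comp_def)
qed

context
  fixes g X Y
  assumes XY: "comodular E L X Y" and g: "X g = Y g" "X g \<noteq> 0"
begin

private lemma elimination_premises: "comodular E L (- X) Y" "g \<in> sep (- X) Y"
  using comodular_uminus_left[OF XY] g by (simp_all add: mem_sep_uminus_iff)

lemma edge_direction_at_infinity: "edge_direction L g X Y g = 0"
  unfolding edge_direction_def by (rule cocircuit_elim_covector(2)[OF elimination_premises])

lemma edge_direction_apply: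
  "X h \<noteq> Y h \<or> X h = 0 \<Longrightarrow> edge_direction L g X Y h = sv_comp (- X) Y h"
  using cocircuit_elim_covector(3)[OF elimination_premises, of h]
  by (auto simp: edge_direction_def mem_sep_uminus_iff)

lemma edge_direction_in_line: "edge_direction L g X Y \<in> line_covectors E L X Y"
  using cocircuit_elim_covector(1)[OF elimination_premises] edge_direction_apply
  by (simp add: mem_line_covectors_iff[OF comodular_covectors[OF XY]] edge_direction_def sv_comp_def)

lemma edge_direction_nonzero: "X k \<noteq> Y k \<Longrightarrow> edge_direction L g X Y k \<noteq> 0"
  by (simp add: edge_direction_apply sv_comp_def)

lemma edge_direction_cocircuit: "edge_direction L g X Y \<in> cocircuits L"
proof -
  have X: "X \<in> line_covectors E L X Y"
    using comodular_covectors[OF XY] by (simp add: mem_line_covectors_iff)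
  obtain k where "X k \<noteq> Y k" using XY by (auto simp: comodular_def fun_eq_iff)
  then have "edge_direction L g X Y \<noteq> (\<lambda>_. 0)" using edge_direction_nonzero by (metis (full_types))
  then show ?thesis
    by (rule line_cocircuit[OF XY X g(2) edge_direction_in_line edge_direction_at_infinity])
qed

lemma edge_direction_uminus: "edge_direction L g (- X) (- Y) = - edge_direction L g X Y"
  using cocircuit_elim_uminus[OF elimination_premises] by (simp add: edge_direction_def)

lemma edge_direction_commute: "edge_direction L g Y X = - edge_direction L g X Y"
  using edge_direction_uminus by (metis cocircuit_elim_commute edge_direction_def minus_minus)

lemma edge_objective_mono:
  assumes "0 \<le> edge_direction L g X Y f"
  shows "X f \<le> Y f"
proof (cases "X f = Y f")
  case ne: False
  note cov = comodular_covectors[OF XY]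
  have "0 \<le> sv_comp (- X) Y f" using assms ne by (simp add: edge_direction_apply)
  then show ?thesis
    using ne covector_sign[OF cov(1), of f] covector_sign[OF cov(2), of f]
    by (auto simp: sv_comp_def split: if_splits)
qed simp

end

end

section \<open>Infinitesimal perturbations in rank two\<close>

text \<open>The element \<open>p\<close> is \<open>\<alpha> * e\<close> plus an infinitesimal: no element but \<open>p\<close> vanishes strictly between
  the points at which \<open>e\<close> and \<open>p\<close> vanish.\<close>

locale perturbed_line = rank_two_oriented_matroid +
  fixes p e :: 'a and \<alpha> :: int
  assumes sign: "\<alpha> = 1 \<or> \<alpha> = -1"
    and perturbed_value:
      "\<lbrakk>V \<in> L; V e \<noteq> 0; V g = 0; g \<noteq> p; U \<in> L; U g \<noteq> 0\<rbrakk> \<Longrightarrow> V p = \<alpha> * V e"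
begin

lemma sign_square: "\<alpha> * \<alpha> = 1"
  using sign by auto

lemma agree_near_crossing:
  assumes Z: "Z \<in> L" "Z p = 0" and U: "U \<in> L" "U e = 0" "U p \<noteq> 0"
    and e: "Z e = - \<alpha> * U p" and k: "k \<noteq> p" "U k \<noteq> 0"
  shows "Z k = U k"
proof (rule ccontr)
  assume ne: "Z k \<noteq> U k"
  have Ze: "Z e \<noteq> 0" using e U(3) sign by auto
  have "Z k \<noteq> 0"
  proof
    assume "Z k = 0"
    from perturbed_value[OF Z(1) Ze this k(1) U(1) k(2)] show False using Z(2) Ze sign by auto
  qed
  then have "k \<in> sep Z U"
    using ne k(2) covector_equal_or_opposite[OF Z(1) U(1)] by (auto simp: sep_def)
  then obtain W where W: "W \<in> L" "W k = 0" "\<And>h. h \<notin> sep Z U \<Longrightarrow> W h = sv_comp Z U h"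
    using covector_elimination[OF Z(1) U(1)] by blast
  have "W p = U p" "W e = Z e"
    using W(3)[of p] W(3)[of e] Z(2) U(2) Ze by (simp_all add: sep_def sv_comp_def)
  moreover from this have "W p = \<alpha> * W e"
    using Ze by (intro perturbed_value[OF W(1) _ W(2) k(1) U(1) k(2)]) simp
  ultimately have "U p = - (\<alpha> * \<alpha>) * U p" using e by simp
  then show False using U(3) by (simp add: sign_square)
qed

context
  fixes X Z U k
  assumes X: "X \<in> L" "X p \<noteq> 0" "X e = \<alpha>"
    and Z: "Z \<in> L" "Z p = 0" and U: "U \<in> L" "U e = 0"
    and k: "k \<noteq> p" "Z k = U k" "U k \<noteq> 0"
begin

lemma eq_of_unperturbed: "U p = 0 \<Longrightarrow> Z = U"
  using eq_of_common_sign[OF X(1,2) Z U(1) _ k(2)] k(2,3) by simp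

lemma value_at_unperturbed: "Z e = - \<alpha> * U p"
proof (cases "U p = 0")
  case True
  then show ?thesis using eq_of_unperturbed U(2) by simp
next
  case Up: False
  have nz: "X e \<noteq> 0" using X(3) sign by auto
  have "Z e \<noteq> 0"
  proof
    assume "Z e = 0"
    then have "Z = U" using eq_of_common_sign[OF X(1) nz Z(1) _ U k(2)] k(2,3) by simp
    then show False using Z(2) Up by simp
  qed
  moreover have "Z e \<noteq> \<alpha> * U p"
  proof
    assume "Z e = \<alpha> * U p"
    then have "(- Z) k = U k"
      using Z(2) by (intro agree_near_crossing[OF uminus_covector[OF Z(1)] _ U Up _ k(1,3)]) simp_all
    then show False using k(2,3) by simp
  qed
  ultimately show ?thesis
    using sign Up covector_sign[OF Z(1), of e] covector_sign[OF U(1), of p] by auto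
qed

lemma agree_on_support:
  assumes "f \<noteq> p" "U f \<noteq> 0"
  shows "Z f = U f"
proof (cases "U p = 0")
  case True
  then show ?thesis using eq_of_unperturbed by simp
next
  case False
  then show ?thesis by (rule agree_near_crossing[OF Z U _ value_at_unperturbed assms])
qed

lemma value_at_parallel:
  assumes f: "f \<noteq> p" "U f = 0"
  shows "Z f = - X f * U p"
proof -
  have nz: "X e \<noteq> 0" using X(3) sign by auto
  have Unz: "U \<noteq> (\<lambda>_. 0)" using k(3) by auto
  have parallel: "X f = W f" if "W \<in> L" "W e = \<alpha>" for W
    using parallel_values[OF U(1) Unz U(2) f(2) X(1) that(1) _ nz] X(3) that(2) by simp
  consider "U p = 0" | "U p = 1" | "U p = -1" using covector_sign[OF U(1), of p] by blast
  then show ?thesis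
  proof cases
    case 1
    then show ?thesis using eq_of_unperturbed f(2) by simp
  next
    case 2
    then have "X f = (- Z) f"
      using value_at_unperturbed Z(1) by (intro parallel uminus_covector) simp_all
    then show ?thesis using 2 by simp
  next
    case 3
    then have "X f = Z f" using value_at_unperturbed Z(1) by (intro parallel) simp_all
    then show ?thesis using 3 by simp
  qed
qed

end

end

section \<open>Single-element extensions\<close>

locale localized_extension =
  base: oriented_matroid_covectors E L + ext: oriented_matroid_covectors "insert p E" L'
  for E :: "'a set" and L :: "'a sign_vec set" and p :: 'a and L' :: "'a sign_vec set" +
  fixes \<sigma> :: "'a sign_vec \<Rightarrow> int"
  assumes single_element_extension: "single_element_extension E L p \<sigma> L'"
begin

lemma new_element: "p \<notin> E"
  and deletion: "(\<lambda>V. V(p := 0)) ` L' = L"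
  and rank_preserved: "mat_rank (insert p E) L' (insert p E) = mat_rank E L E"
  and localization: "Y \<in> cocircuits L \<Longrightarrow> Y(p := \<sigma> Y) \<in> cocircuits L'"
  using single_element_extension by (simp_all add: single_element_extension_def)

lemma delete_covector: "V \<in> L' \<Longrightarrow> V(p := 0) \<in> L"
  using deletion by blast

lemma contraction_deletion:
  assumes "A \<subseteq> E"
  shows "(\<lambda>V. V(p := 0)) ` contraction L' A = contraction L A"
proof -
  have "(\<forall>a\<in>A. (V(p := 0)) a = 0) \<longleftrightarrow> (\<forall>a\<in>A. V a = 0)" for V :: "'a sign_vec"
    using assms new_element by auto
  then show ?thesis
    unfolding contraction_def deletion[symmetric] Compr_image_eq by (simp only:)
qed

lemma indep_deletion:
  assumes A: "A \<subseteq> E"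
  shows "mat_indep (insert p E) L' A \<longleftrightarrow> mat_indep E L A"
proof -
  have "(\<exists>V\<in>contraction L' (A - {a}). V a \<noteq> 0) \<longleftrightarrow> (\<exists>V\<in>contraction L (A - {a}). V a \<noteq> 0)"
    if "a \<in> A" for a
  proof -
    have "A - {a} \<subseteq> E" "a \<noteq> p" using A that new_element by auto
    then show ?thesis by (simp add: contraction_deletion[symmetric])
  qed
  then show ?thesis using A by (auto simp: ext.indep_iff base.indep_iff)
qed

lemma rank_deletion:
  assumes "A \<subseteq> E"
  shows "mat_rank (insert p E) L' A = mat_rank E L A"
proof -
  have "B \<subseteq> A \<and> mat_indep (insert p E) L' B \<longleftrightarrow> B \<subseteq> A \<and> mat_indep E L B" for B
    using assms indep_deletion[of B] by blast
  then show ?thesis by (simp add: mat_rank_def)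
qed

lemma delete_covector_eq_zero:
  assumes V: "V \<in> L'" "V(p := 0) = (\<lambda>_. 0)"
  shows "V = (\<lambda>_. 0)"
proof -
  obtain A where A: "A \<subseteq> E" "mat_indep (insert p E) L' A" "card A = mat_rank (insert p E) L' E"
    by (rule ext.rank_attained)
  have zero: "V h = 0" if "h \<noteq> p" for h using fun_cong[OF V(2), of h] that by simp
  then have "V a = 0" if "a \<in> A" for a
    using A(1) new_element that by (intro zero) auto
  then have "V \<in> contraction L' A" using V(1) by (simp add: contraction_def)
  also have "contraction L' A = contraction L' (insert p E)"
    using A rank_deletion[of E] rank_preserved by (intro ext.contraction_maximal_indep) auto
  finally have "V p = 0" by (simp add: contraction_def)
  then have "V h = 0" for h using zero by (cases "h = p") simp_all
  then show ?thesis by blast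
qed

lemma covector_over_cocircuit_unique:
  assumes V: "V \<in> L'" "V(p := 0) \<in> cocircuits L" and W: "W \<in> L'" "W(p := 0) = V(p := 0)"
  shows "W = V"
proof (rule ccontr)
  assume "W \<noteq> V"
  then have ne: "V p \<noteq> W p" using W(2) by (metis fun_upd_triv fun_upd_upd)
  have agree: "W h = V h" if "h \<noteq> p" for h using fun_cong[OF W(2), of h] that by simp
  have "V(p := 0) \<noteq> (\<lambda>_. 0)" using V(2) by (simp add: cocircuits_def)
  then obtain e where "(V(p := 0)) e \<noteq> 0" by blast
  then have e: "e \<noteq> p" "V e \<noteq> 0" by (auto split: if_splits)
  then obtain Z where Z: "Z \<in> L'" "Z e = 0"
    "\<And>h. V h \<noteq> W h \<or> V h = 0 \<Longrightarrow> Z h = sv_comp (- V) W h"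
    using ext.covector_difference[OF V(1) W(1), of e] agree[of e] by auto
  have "Z h = 0" if "h \<noteq> p" "V h = 0" for h
    using Z(3)[of h] that agree[of h] by (simp add: sv_comp_def)
  then have "supp (Z(p := 0)) \<subseteq> supp (V(p := 0))" by (auto simp: supp_def)
  moreover have "e \<in> supp (V(p := 0))" "e \<notin> supp (Z(p := 0))"
    using e Z(2) by (simp_all add: supp_def)
  ultimately have "Z(p := 0) = (\<lambda>_. 0)"
    using base.cocircuit_support_minimal[OF V(2) delete_covector[OF Z(1)]] by blast
  then have "Z p = 0" using delete_covector_eq_zero[OF Z(1)] by simp
  moreover have "Z p = sv_comp (- V) W p" using Z(3)[of p] ne by simp
  ultimately show False using ne by (simp add: sv_comp_def split: if_splits)
qed

lemma value_at_new_element: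
  assumes V: "V \<in> L'" "V(p := 0) \<in> cocircuits L"
  shows "V p = \<sigma> (V(p := 0))"
proof -
  have "V(p := \<sigma> (V(p := 0))) \<in> L'" using localization[OF V(2)] by (simp add: cocircuits_def)
  then have "V(p := \<sigma> (V(p := 0))) = V" by (rule covector_over_cocircuit_unique[OF V]) simp
  from fun_cong[OF this, of p] show ?thesis by simp
qed

lemma delete_cocircuit:
  assumes V: "V \<in> cocircuits L'" "V p \<noteq> 0"
  shows "V(p := 0) \<in> cocircuits L"
proof -
  have VL: "V \<in> L'" and "V \<noteq> (\<lambda>_. 0)" using V(1) by (simp_all add: cocircuits_def)
  then have nz: "V(p := 0) \<noteq> (\<lambda>_. 0)" using delete_covector_eq_zero by blast
  have "W = V(p := 0)" if W: "W \<in> L" "W \<noteq> (\<lambda>_. 0)" "face_le W (V(p := 0))" for W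
  proof -
    obtain W' where W': "W' \<in> L'" "W = W'(p := 0)" using W(1) deletion by blast
    have W'nz: "W' \<noteq> (\<lambda>_. 0)" using W(2) W'(2) by auto
    have "W' h = 0" if "V h = 0" for h
      using W(3) V(2) that by (cases "h = p") (auto simp: W'(2) face_le_def split: if_splits)
    then have "supp W' \<subseteq> supp V" by (auto simp: supp_def)
    then have "supp W' = supp V"
      using ext.cocircuit_support_minimal[OF V(1) W'(1)] W'nz by blast
    then have "W' h = 0 \<longleftrightarrow> V h = 0" for h by (auto simp: supp_def)
    then show ?thesis using W(3) by (auto simp: W'(2) face_le_def fun_eq_iff split: if_splits)
  qed
  then show ?thesis using delete_covector[OF VL] nz by (simp add: cocircuits_def)
qed

lemma delete_comodular:
  assumes XY: "comodular (insert p E) L' X Y" and p: "X p = Y p" "X p \<noteq> 0"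
  shows "comodular E L (X(p := 0)) (Y(p := 0))"
proof -
  let ?X = "X(p := 0)" and ?Y = "Y(p := 0)"
  have cc: "X \<in> cocircuits L'" "Y \<in> cocircuits L'" and ne: "X \<noteq> Y" "X \<noteq> - Y"
    using XY by (simp_all add: comodular_def)
  have cov: "X \<in> L'" "Y \<in> L'" using cc by (simp_all add: cocircuits_def)
  have cc0: "?X \<in> cocircuits L" "?Y \<in> cocircuits L" using delete_cocircuit cc p by simp_all
  have "?X \<noteq> ?Y" using covector_over_cocircuit_unique[OF cov(1) cc0(1) cov(2)] ne(1) by metis
  moreover have "?X \<noteq> - ?Y"
  proof
    assume "?X = - ?Y"
    then have "(- Y)(p := 0) = ?X" by (auto simp: fun_eq_iff)
    then have "- Y = X"
      using covector_over_cocircuit_unique[OF cov(1) cc0(1)] ext.uminus_covector[OF cov(2)] by blast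
    then show False using ne(2) by simp
  qed
  moreover have zero_set: "zero_set (insert p E) X = zero_set E ?X"
    "zero_set (insert p E) Y = zero_set E ?Y"
    using p new_element by (auto simp: zero_set_def supp_def)
  have "zero_set E V \<subseteq> E" for V by (auto simp: zero_set_def)
  then have "modular_pair E L (zero_set E ?X) (zero_set E ?Y)"
    using XY unfolding comodular_def modular_pair_def zero_set
    by (simp add: rank_deletion le_infI1)
  ultimately show ?thesis using cc0 by (simp add: comodular_def)
qed

lemma delete_line_covector:
  assumes XY: "X \<in> L'" "Y \<in> L'" and V: "V \<in> line_covectors (insert p E) L' X Y"
  shows "V(p := 0) \<in> line_covectors E L (X(p := 0)) (Y(p := 0))"
  using V delete_covector XY
  by (auto simp: ext.mem_line_covectors_iff[OF XY]
      base.mem_line_covectors_iff[OF delete_covector[OF XY(1)] delete_covector[OF XY(2)]])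

end

section \<open>Closed walks\<close>

definition walk_edges :: "'b list \<Rightarrow> ('b \<times> 'b) set" where
  "walk_edges Ps = (\<lambda>i. (Ps ! i, Ps ! Suc i)) ` {i. Suc i < length Ps}"

lemma walk_edges_in_set:
  assumes "(X, Y) \<in> walk_edges Ps"
  shows "X \<in> set Ps" "Y \<in> set Ps"
  using assms by (auto simp: walk_edges_def)

lemma walk_edges_map: "walk_edges (map h Ps) = map_prod h h ` walk_edges Ps"
  by (simp add: walk_edges_def image_image cong: image_cong_simp)

lemma walk_edges_rev: "(X, Y) \<in> walk_edges (rev Ps) \<longleftrightarrow> (Y, X) \<in> walk_edges Ps"
proof -
  have "(Y, X) \<in> walk_edges (rev Qs)" if XY: "(X, Y) \<in> walk_edges Qs" for X Y :: 'a and Qs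
  proof -
    obtain i where i: "Suc i < length Qs" "X = Qs ! i" "Y = Qs ! Suc i"
      using XY by (auto simp: walk_edges_def)
    let ?j = "length Qs - Suc (Suc i)"
    have "Suc ?j < length (rev Qs)" "rev Qs ! ?j = Y" "rev Qs ! Suc ?j = X"
      using i by (auto simp: rev_nth Suc_diff_Suc)
    then show ?thesis unfolding walk_edges_def by blast
  qed
  from this[of X Y "rev Ps"] this[of Y X Ps] show ?thesis by auto
qed

lemma closed_walk_mono_constant:
  fixes a :: "'b \<Rightarrow> 'c :: order"
  assumes mono: "\<And>X Y. (X, Y) \<in> walk_edges Ps \<Longrightarrow> a X \<le> a Y"
    and closed: "last Ps = hd Ps" and V: "V \<in> set Ps"
  shows "a V = a (hd Ps)"
proof -
  have up: "a (Ps ! i) \<le> a (Ps ! j)" if "i \<le> j" "j < length Ps" for i j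
    using that
  proof (induction j rule: dec_induct)
    case (step j)
    then have "a (Ps ! j) \<le> a (Ps ! Suc j)" by (intro mono) (auto simp: walk_edges_def)
    with step show ?case by (auto intro: order_trans)
  qed simp
  obtain i where i: "i < length Ps" "V = Ps ! i" using V by (auto simp: in_set_conv_nth)
  then have "Ps \<noteq> []" by auto
  then have ends: "hd Ps = Ps ! 0" "hd Ps = Ps ! (length Ps - 1)"
    using hd_conv_nth last_conv_nth closed by metis+
  have "a (hd Ps) \<le> a V" unfolding ends(1) i(2) by (rule up[OF _ i(1)]) simp
  moreover have "a V \<le> a (hd Ps)" unfolding ends(2) i(2) using i(1) by (intro up) auto
  ultimately show ?thesis by simp
qed

definition closed_walk :: "'a set \<Rightarrow> 'a sign_vec set \<Rightarrow> 'a \<Rightarrow> int \<Rightarrow> 'a sign_vec list \<Rightarrow> bool" where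
  "closed_walk E L g \<alpha> Ps \<longleftrightarrow> Ps \<noteq> [] \<and> last Ps = hd Ps \<and> distinct (butlast Ps) \<and>
     (\<forall>X\<in>set Ps. X \<in> cocircuits L \<and> X g = \<alpha>) \<and>
     (\<forall>(X, Y)\<in>walk_edges Ps. conformal X Y \<and> comodular E L X Y)"

lemma closed_walk_vertex:
  assumes "closed_walk E L g \<alpha> Ps" "X \<in> set Ps"
  shows "X \<in> cocircuits L" "X g = \<alpha>"
  using assms by (simp_all add: closed_walk_def)

lemma closed_walk_edge:
  assumes "closed_walk E L g \<alpha> Ps" "(X, Y) \<in> walk_edges Ps"
  shows "conformal X Y" "comodular E L X Y" "X g = \<alpha>" "Y g = \<alpha>"
proof -
  show "conformal X Y" "comodular E L X Y" using assms by (auto simp: closed_walk_def)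
  show "X g = \<alpha>" "Y g = \<alpha>"
    using closed_walk_vertex(2)[OF assms(1)] walk_edges_in_set[OF assms(2)] by blast+
qed

lemma closed_walk_at_one_iff:
  "closed_walk E L g 1 Ps \<longleftrightarrow>
    Ps \<noteq> [] \<and> set Ps \<subseteq> graph_verts L g \<and> last Ps = hd Ps \<and> distinct (butlast Ps) \<and>
    (\<forall>(X, Y)\<in>walk_edges Ps. graph_adj E L g X Y)"
proof -
  have "set Ps \<subseteq> graph_verts L g \<longleftrightarrow> (\<forall>X\<in>set Ps. X \<in> cocircuits L \<and> X g = 1)"
    by (auto simp: graph_verts_def)
  moreover have "graph_adj E L g X Y \<longleftrightarrow> conformal X Y \<and> comodular E L X Y"
    if "set Ps \<subseteq> graph_verts L g" "(X, Y) \<in> walk_edges Ps" for X Y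
    using walk_edges_in_set[OF that(2)] that(1) by (auto simp: graph_adj_def)
  ultimately show ?thesis unfolding closed_walk_def by blast
qed

lemma closed_walk_rev:
  assumes walk: "closed_walk E L g \<alpha> Ps"
  shows "closed_walk E L g \<alpha> (rev Ps)"
proof -
  obtain X Qs where Ps: "Ps = X # Qs" using walk by (cases Ps) (auto simp: closed_walk_def)
  have "distinct Qs"
    using walk unfolding Ps closed_walk_def by (cases Qs rule: rev_cases) auto
  then have "distinct (butlast (rev Ps))" by (simp add: Ps butlast_append)
  moreover have "conformal X Y \<and> comodular E L X Y" if "(X, Y) \<in> walk_edges (rev Ps)" for X Y
    using closed_walk_edge(1,2)[OF walk, of Y X] that comodular_commute[of E L Y X]
    by (simp add: walk_edges_rev conformal_def sep_commute[of X Y])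
  ultimately show ?thesis
    using walk by (auto simp: closed_walk_def hd_rev last_rev)
qed

context oriented_matroid_covectors
begin

lemma closed_walk_uminus:
  assumes walk: "closed_walk E L g \<alpha> Ps"
  shows "closed_walk E L g (- \<alpha>) (map uminus Ps)"
proof -
  have "distinct (butlast (map uminus Ps))"
    using walk by (simp add: closed_walk_def distinct_map flip: map_butlast)
  moreover have "conformal (- X) (- Y) \<and> comodular E L (- X) (- Y)"
    if "(X, Y) \<in> walk_edges Ps" for X Y
    using closed_walk_edge(1,2)[OF walk that] comodular_uminus by (simp add: conformal_def)
  ultimately show ?thesis
    using walk uminus_cocircuit by (auto simp: closed_walk_def hd_map last_map walk_edges_map)
qed

lemma directed_cycle_iff:
  "directed_cycle E L g f Ps \<longleftrightarrow> closed_walk E L g 1 Ps \<and>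
     (\<forall>(X, Y)\<in>walk_edges Ps. 0 \<le> edge_direction L g X Y f) \<and>
     (\<exists>(X, Y)\<in>walk_edges Ps. edge_direction L g X Y f \<noteq> 0)"
proof -
  have "directed_cycle E L g f Ps \<longleftrightarrow>
    Ps \<noteq> [] \<and> set Ps \<subseteq> graph_verts L g \<and> last Ps = hd Ps \<and> distinct (butlast Ps) \<and>
    (\<forall>(X, Y)\<in>walk_edges Ps. graph_adj E L g X Y \<and>
       (edge_fwd L g f X Y \<or> edge_undirected L g f X Y)) \<and>
    \<not> (\<forall>(X, Y)\<in>walk_edges Ps. edge_undirected L g f X Y)"
    by (simp add: directed_cycle_def walk_edges_def)
  also have "\<dots> \<longleftrightarrow> closed_walk E L g 1 Ps \<and>
    (\<forall>(X, Y)\<in>walk_edges Ps. edge_fwd L g f X Y \<or> edge_undirected L g f X Y) \<and>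
    \<not> (\<forall>(X, Y)\<in>walk_edges Ps. edge_undirected L g f X Y)"
    unfolding closed_walk_at_one_iff by blast
  also have "\<dots> \<longleftrightarrow> closed_walk E L g 1 Ps \<and>
    (\<forall>(X, Y)\<in>walk_edges Ps. 0 \<le> edge_direction L g X Y f) \<and>
    (\<exists>(X, Y)\<in>walk_edges Ps. edge_direction L g X Y f \<noteq> 0)"
  proof -
    have "edge_fwd L g f X Y \<or> edge_undirected L g f X Y \<longleftrightarrow> 0 \<le> edge_direction L g X Y f"
      if "closed_walk E L g 1 Ps" "(X, Y) \<in> walk_edges Ps" for X Y
    proof -
      have "edge_direction L g X Y \<in> L"
        using closed_walk_edge[OF that] edge_direction_cocircuit by (simp add: cocircuits_def)
      then show ?thesis
        using covector_sign[of "edge_direction L g X Y" f]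
        by (auto simp: edge_fwd_def edge_undirected_def edge_direction_def)
    qed
    moreover have "edge_undirected L g f X Y \<longleftrightarrow> edge_direction L g X Y f = 0" for X Y
      by (simp add: edge_undirected_def edge_direction_def)
    ultimately show ?thesis by blast
  qed
  finally show ?thesis .
qed

lemma closed_walk_objective_constant:
  assumes walk: "closed_walk E L g \<alpha> Ps" "\<alpha> \<noteq> 0"
    and mono: "\<And>X Y. (X, Y) \<in> walk_edges Ps \<Longrightarrow> 0 \<le> edge_direction L g X Y f"
    and V: "V \<in> set Ps"
  shows "V f = hd Ps f"
proof (rule closed_walk_mono_constant[where a = "\<lambda>V. V f", OF _ _ V])
  show "last Ps = hd Ps" using walk(1) by (simp add: closed_walk_def)
  show "X f \<le> Y f" if "(X, Y) \<in> walk_edges Ps" for X Y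
    using closed_walk_edge[OF walk(1) that] walk(2) mono[OF that]
    by (intro edge_objective_mono) auto
qed

end

lemma (in localized_extension) closed_walk_deletion:
  assumes walk: "closed_walk (insert p E) L' p \<beta> Ps" "\<beta> \<noteq> 0"
    and g: "g \<noteq> p" "\<And>V. V \<in> set Ps \<Longrightarrow> V g = \<alpha>"
  shows "closed_walk E L g \<alpha> (map (\<lambda>V. V(p := 0)) Ps)"
proof -
  have "inj_on (\<lambda>V. V(p := 0)) (set (butlast Ps))"
  proof (rule inj_onI)
    fix V W assume "V \<in> set (butlast Ps)" "W \<in> set (butlast Ps)" and eq: "V(p := 0) = W(p := 0)"
    then have "V p = W p" using closed_walk_vertex(2)[OF walk(1)] by (metis in_set_butlastD)
    then show "V = W" using eq by (metis fun_upd_triv fun_upd_upd)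
  qed
  then have "distinct (butlast (map (\<lambda>V. V(p := 0)) Ps))"
    using walk(1) by (simp add: closed_walk_def distinct_map flip: map_butlast)
  moreover have "V(p := 0) \<in> cocircuits L \<and> (V(p := 0)) g = \<alpha>" if "V \<in> set Ps" for V
    using closed_walk_vertex[OF walk(1) that] walk(2) g that by (simp add: delete_cocircuit)
  moreover have "conformal (X(p := 0)) (Y(p := 0)) \<and> comodular E L (X(p := 0)) (Y(p := 0))"
    if "(X, Y) \<in> walk_edges Ps" for X Y
  proof -
    have "sep (X(p := 0)) (Y(p := 0)) \<subseteq> sep X Y" by (auto simp: sep_def)
    then show ?thesis
      using closed_walk_edge[OF walk(1) that] walk(2) by (auto simp: conformal_def delete_comodular)
  qed
  ultimately show ?thesis
    using walk(1) by (auto simp: closed_walk_def hd_map last_map walk_edges_map)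
qed

section \<open>Closed walks in Euclidean oriented matroids\<close>

context oriented_matroid_covectors
begin

context
  assumes euclidean: "euclidean_om E L"
begin

lemma no_directed_cycle_of_objective:
  assumes f: "f \<in> E" and g: "X \<in> L" "X g \<noteq> 0" and "g \<noteq> f" "\<not> mat_coloop E L f"
  shows "\<not> directed_cycle E L g f Ps"
proof -
  have "g \<in> E" using covector_outside g by blast
  have "mat_indep E L {g}"
    using g by (intro indep_insert[OF indep_empty]) (simp_all add: contraction_def)
  then have "om_program E L g f"
    using assms \<open>g \<in> E\<close> oriented_matroid by (simp add: om_program_def mat_loop_def)
  then show ?thesis using euclidean by (simp add: euclidean_om_def euclidean_program_def)
qed

lemma closed_walk_nonneg_direction_zero:
  assumes f: "f \<in> E" and walk: "closed_walk E L g 1 Ps"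
    and mono: "\<And>X Y. (X, Y) \<in> walk_edges Ps \<Longrightarrow> 0 \<le> edge_direction L g X Y f"
    and XY: "(X, Y) \<in> walk_edges Ps"
  shows "edge_direction L g X Y f = 0"
proof -
  note edge = closed_walk_edge[OF walk XY]
  have g: "X g = Y g" "X g \<noteq> 0" using edge by simp_all
  consider "g = f" | "g \<noteq> f" "mat_coloop E L f" | "g \<noteq> f" "\<not> mat_coloop E L f" by blast
  then show ?thesis
  proof cases
    case 1
    then show ?thesis using edge_direction_at_infinity[OF edge(2) g] by simp
  next
    case 2
    then have "X f = 0" "Y f = 0"
      using edge g coloop_zero_on_cocircuit[OF 2(2), of _ g] by (auto simp: comodular_def)
    then show ?thesis using edge_direction_apply[OF edge(2) g] by (simp add: sv_comp_def)
  next
    case 3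
    then have "\<not> directed_cycle E L g f Ps"
      using no_directed_cycle_of_objective[OF f comodular_covectors(1)[OF edge(2)] g(2)] by blast
    then show ?thesis using walk mono XY by (auto simp: directed_cycle_iff)
  qed
qed

lemma closed_walk_one_sided_direction_zero:
  assumes f: "f \<in> E" and walk: "closed_walk E L g 1 Ps" and s: "s = 1 \<or> s = -1"
    and mono: "\<And>X Y. (X, Y) \<in> walk_edges Ps \<Longrightarrow> 0 \<le> s * edge_direction L g X Y f"
    and XY: "(X, Y) \<in> walk_edges Ps"
  shows "edge_direction L g X Y f = 0"
proof (cases "s = 1")
  case True
  then show ?thesis using closed_walk_nonneg_direction_zero[OF f walk _ XY] mono by simp
next
  case False
  have reverse: "edge_direction L g Y X f = - edge_direction L g X Y f"
    if "(X, Y) \<in> walk_edges Ps" for X Y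
    using closed_walk_edge[OF walk that] edge_direction_commute by simp
  have "edge_direction L g Y X f = 0"
  proof (rule closed_walk_nonneg_direction_zero[OF f closed_walk_rev[OF walk]])
    show "0 \<le> edge_direction L g V W f" if "(V, W) \<in> walk_edges (rev Ps)" for V W
      using that reverse mono[of W V] False s by (auto simp: walk_edges_rev)
  qed (use XY in \<open>simp add: walk_edges_rev\<close>)
  then show ?thesis using reverse[OF XY] by simp
qed

lemma closed_walk_direction_zero:
  assumes f: "f \<in> E" and walk: "closed_walk E L g \<alpha> Ps"
    and sign: "\<alpha> = 1 \<or> \<alpha> = -1" "s = 1 \<or> s = -1"
    and mono: "\<And>X Y. (X, Y) \<in> walk_edges Ps \<Longrightarrow> 0 \<le> s * edge_direction L g X Y f"
    and XY: "(X, Y) \<in> walk_edges Ps"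
  shows "edge_direction L g X Y f = 0"
proof (cases "\<alpha> = 1")
  case True
  then show ?thesis using closed_walk_one_sided_direction_zero[OF f _ sign(2) mono XY] walk by simp
next
  case False
  have opposite: "edge_direction L g (- X) (- Y) f = - edge_direction L g X Y f"
    if "(X, Y) \<in> walk_edges Ps" for X Y
    using closed_walk_edge[OF walk that] sign(1) by (subst edge_direction_uminus) auto
  have "edge_direction L g (- X) (- Y) f = 0"
  proof (rule closed_walk_one_sided_direction_zero[OF f])
    show "closed_walk E L g 1 (map uminus Ps)"
      using closed_walk_uminus[OF walk] False sign(1) by simp
    show "- s = 1 \<or> - s = -1" using sign(2) by auto
    show "0 \<le> - s * edge_direction L g V W f" if "(V, W) \<in> walk_edges (map uminus Ps)" for V W
      using that opposite mono by (auto simp: walk_edges_map)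
    show "(- X, - Y) \<in> walk_edges (map uminus Ps)" using XY by (force simp: walk_edges_map)
  qed
  then show ?thesis using opposite[OF XY] by simp
qed

lemma closed_walk_lex_localization_zero:
  assumes walk: "closed_walk E L g \<alpha> Ps"
    and sign: "\<alpha> = 1 \<or> \<alpha> = -1" "s = 1 \<or> s = -1"
    and I: "fst ` set I \<subseteq> E" "snd ` set I \<subseteq> {1, -1}"
    and mono: "\<And>X Y. (X, Y) \<in> walk_edges Ps \<Longrightarrow> 0 \<le> s * lex_localization I (edge_direction L g X Y)"
    and XY: "(X, Y) \<in> walk_edges Ps"
  shows "lex_localization I (edge_direction L g X Y) = 0"
  using I mono
proof (induction I)
  case (Cons d\<beta> I)
  obtain d \<beta> where d\<beta>: "d\<beta> = (d, \<beta>)" by (cases d\<beta>)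
  then have d: "d \<in> E" and \<beta>: "\<beta> = 1 \<or> \<beta> = -1" using Cons.prems(1,2) by auto
  have zero: "edge_direction L g V W d = 0" if "(V, W) \<in> walk_edges Ps" for V W
  proof (rule closed_walk_direction_zero[OF d walk sign(1), where s = "s * \<beta>"])
    show "s * \<beta> = 1 \<or> s * \<beta> = -1" using sign(2) \<beta> by auto
    show "0 \<le> s * \<beta> * edge_direction L g V W d" if "(V, W) \<in> walk_edges Ps" for V W
      using Cons.prems(3)[OF that] by (auto simp: d\<beta> mult.assoc split: if_splits)
  qed (rule that)
  show ?case using Cons zero[OF XY] zero by (simp add: d\<beta>)
qed simp

end

end

section \<open>Lexicographic extensions\<close>

lemma lex_localization_eq_zero: "(\<And>d. d \<in> fst ` set I \<Longrightarrow> Y d = 0) \<Longrightarrow> lex_localization I Y = 0"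
  by (induction I) auto

lemma lex_localization_first_nonzero:
  "(\<And>d. d \<in> fst ` set I \<Longrightarrow> Y d = 0) \<Longrightarrow> Y e \<noteq> 0 \<Longrightarrow> lex_localization (I @ (e, \<alpha>) # J) Y = \<alpha> * Y e"
  by (induction I) auto

locale split_lexicographic_extension =
  localized_extension E L p L' "lex_localization (I @ (e, \<alpha>) # J)"
  for E :: "'a set" and L :: "'a sign_vec set" and p :: 'a and L' :: "'a sign_vec set"
    and I :: "('a \<times> int) list" and e :: 'a and \<alpha> :: int and J :: "('a \<times> int) list" +
  assumes sign: "\<alpha> = 1 \<or> \<alpha> = -1" and e_neq_p: "e \<noteq> p"
begin

lemma value_at_p:
  assumes V: "V \<in> L'" "V(p := 0) \<in> cocircuits L"
    and initial: "\<And>d. d \<in> fst ` set I \<Longrightarrow> V d = 0" and e: "V e \<noteq> 0"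
  shows "V p = \<alpha> * V e"
proof -
  have "V p = lex_localization (I @ (e, \<alpha>) # J) (V(p := 0))" by (rule value_at_new_element[OF V])
  also have "\<dots> = \<alpha> * (V(p := 0)) e"
    using initial e e_neq_p by (intro lex_localization_first_nonzero) auto
  finally show ?thesis using e_neq_p by simp
qed

lemma cocircuit_value_at_e:
  assumes V: "V \<in> cocircuits L'" "V p = 1"
    and initial: "\<And>d. d \<in> fst ` set I \<Longrightarrow> V d = 0" and e: "V e \<noteq> 0"
  shows "V e = \<alpha>"
proof -
  have "V \<in> L'" "V(p := 0) \<in> cocircuits L"
    using V delete_cocircuit by (simp_all add: cocircuits_def)
  then have "1 = \<alpha> * V e" using value_at_p initial e V(2) by metis
  then show ?thesis using sign by auto
qed

end

locale lexicographic_edge = split_lexicographic_extension +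
  fixes X Y :: "'a sign_vec"
  assumes comodular: "comodular (insert p E) L' X Y"
    and ends_at_p: "X p = 1" "Y p = 1"
    and initial_zero: "d \<in> fst ` set I \<Longrightarrow> X d = 0" "d \<in> fst ` set I \<Longrightarrow> Y d = 0"
begin

abbreviation "X\<^sub>0 \<equiv> X(p := 0)"
abbreviation "Y\<^sub>0 \<equiv> Y(p := 0)"
abbreviation "line \<equiv> line_covectors (insert p E) L' X Y"
abbreviation "line\<^sub>0 \<equiv> line_covectors E L X\<^sub>0 Y\<^sub>0"

lemma ends: "X \<in> cocircuits L'" "Y \<in> cocircuits L'" "X \<in> L'" "Y \<in> L'"
  using comodular by (simp_all add: comodular_def cocircuits_def)

lemma mem_line_iff: "V \<in> line \<longleftrightarrow> V \<in> L' \<and> (\<forall>h. X h = 0 \<and> Y h = 0 \<longrightarrow> V h = 0)"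
  by (rule ext.mem_line_covectors_iff[OF ends(3,4)])

lemma ends_in_line: "X \<in> line" "Y \<in> line"
  using ends by (simp_all add: mem_line_iff)

lemma comodular_base: "comodular E L X\<^sub>0 Y\<^sub>0"
  using comodular ends_at_p by (intro delete_comodular) simp_all

sublocale line: perturbed_line "insert p E" line p e \<alpha>
proof (intro perturbed_line.intro perturbed_line_axioms.intro)
  show "rank_two_oriented_matroid (insert p E) line" by (rule ext.rank_two_line[OF comodular])
  show "V p = \<alpha> * V e"
    if V: "V \<in> line" "V e \<noteq> 0" "V g = 0" and g: "g \<noteq> p" and U: "U \<in> line" "U g \<noteq> 0" for V g U
  proof (rule value_at_p)
    have base: "V(p := 0) \<in> line\<^sub>0" "U(p := 0) \<in> line\<^sub>0"
      using delete_line_covector[OF ends(3,4)] V(1) U(1) by blast+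
    have "(V(p := 0)) e \<noteq> 0" using V(2) e_neq_p by simp
    then have nz: "V(p := 0) \<noteq> (\<lambda>_. 0)" by metis
    have "(V(p := 0)) g = 0" "(U(p := 0)) g \<noteq> 0" using V(3) U(2) g by simp_all
    then show "V(p := 0) \<in> cocircuits L"
      using base.line_cocircuit[OF comodular_base base(2) _ base(1) _ nz] by blast
  qed (use V initial_zero in \<open>simp_all add: mem_line_iff\<close>)
qed (rule sign)

lemma lexicographic_edge_commute: "lexicographic_edge E L p L' I e \<alpha> J Y X"
  using ends_at_p initial_zero comodular_commute[OF comodular] by unfold_locales

abbreviation "direction \<equiv> edge_direction L' p X Y"
abbreviation "direction\<^sub>0 \<equiv> edge_direction L e X\<^sub>0 Y\<^sub>0"

lemma direction: "direction \<in> line" "direction p = 0"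
    "X h \<noteq> Y h \<or> X h = 0 \<Longrightarrow> direction h = sv_comp (- X) Y h"
  using ext.edge_direction_in_line[OF comodular] ext.edge_direction_at_infinity[OF comodular]
    ext.edge_direction_apply[OF comodular] ends_at_p by simp_all

lemma direction_leaving:
  assumes e: "X e = 0" "Y e \<noteq> 0" and f: "f \<noteq> p" "X f \<noteq> 0"
  shows "direction f = - X f"
proof -
  have "direction e = \<alpha>"
    using direction(3)[of e] e cocircuit_value_at_e[OF ends(2) ends_at_p(2)] initial_zero
    by (simp add: sv_comp_def)
  then have "direction f = (- X) f"
    by (intro line.agree_near_crossing[OF direction(1,2) line.uminus_covector[OF ends_in_line(1)]])
      (simp_all add: e f ends_at_p)
  then show ?thesis by simp
qed

lemma direction_entering:
  assumes "X e \<noteq> 0" "Y e = 0" "f \<noteq> p" "Y f \<noteq> 0"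
  shows "direction f = Y f"
  using lexicographic_edge.direction_leaving[OF lexicographic_edge_commute assms(2,1,3,4)]
    ext.edge_direction_commute[OF comodular, of p] ends_at_p by simp

context
  assumes ends_nonzero_at_e: "X e \<noteq> 0" "Y e \<noteq> 0"
begin

lemma ends_at_e: "X e = \<alpha>" "Y e = \<alpha>"
  using ends_nonzero_at_e cocircuit_value_at_e ends ends_at_p initial_zero by blast+

lemma direction\<^sub>0: "direction\<^sub>0 \<in> cocircuits L" "direction\<^sub>0 \<in> line\<^sub>0" "direction\<^sub>0 e = 0"
    "X\<^sub>0 h \<noteq> Y\<^sub>0 h \<or> X\<^sub>0 h = 0 \<Longrightarrow> direction\<^sub>0 h = sv_comp (- X\<^sub>0) Y\<^sub>0 h"
proof -
  have e: "X\<^sub>0 e = Y\<^sub>0 e" "X\<^sub>0 e \<noteq> 0" using ends_at_e ends_nonzero_at_e e_neq_p by simp_all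
  show "direction\<^sub>0 \<in> cocircuits L" by (rule base.edge_direction_cocircuit[OF comodular_base e])
  show "direction\<^sub>0 \<in> line\<^sub>0" by (rule base.edge_direction_in_line[OF comodular_base e])
  show "direction\<^sub>0 e = 0" by (rule base.edge_direction_at_infinity[OF comodular_base e])
  show "direction\<^sub>0 h = sv_comp (- X\<^sub>0) Y\<^sub>0 h" if "X\<^sub>0 h \<noteq> Y\<^sub>0 h \<or> X\<^sub>0 h = 0"
    using that by (rule base.edge_direction_apply[OF comodular_base e])
qed

definition "lifted_direction = direction\<^sub>0(p := lex_localization (I @ (e, \<alpha>) # J) direction\<^sub>0)"

lemma lifted_direction_in_line: "lifted_direction \<in> line"
proof -
  have "lifted_direction \<in> L'"
    using localization[OF direction\<^sub>0(1)] by (simp add: lifted_direction_def cocircuits_def)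
  moreover have "lifted_direction h = 0" if "X h = 0" "Y h = 0" for h
    using direction\<^sub>0(4)[of h] that ends_at_p by (auto simp: lifted_direction_def sv_comp_def)
  ultimately show ?thesis by (simp add: mem_line_iff)
qed

lemma common_sign:
  obtains k where "k \<noteq> p" "direction k = lifted_direction k" "lifted_direction k \<noteq> 0"
proof -
  obtain k where k: "X k \<noteq> Y k" using comodular by (auto simp: comodular_def fun_eq_iff)
  moreover from this have "k \<noteq> p" using ends_at_p by auto
  ultimately show thesis
    using that[of k] direction(3)[of k] direction\<^sub>0(4)[of k]
    by (simp add: lifted_direction_def sv_comp_def)
qed

lemma direction_agrees:
  assumes f: "f \<noteq> p" "direction\<^sub>0 f \<noteq> 0"
  shows "direction f = direction\<^sub>0 f"
proof -
  obtain k where k: "k \<noteq> p" "direction k = lifted_direction k" "lifted_direction k \<noteq> 0"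
    by (rule common_sign)
  have "direction f = lifted_direction f"
    by (intro line.agree_on_support[OF ends_in_line(1) _ _ direction(1,2)
          lifted_direction_in_line _ k])
      (simp_all add: lifted_direction_def ends_at_p ends_at_e e_neq_p direction\<^sub>0(3) f)
  then show ?thesis using f(1) by (simp add: lifted_direction_def)
qed

lemma direction_at_parallel:
  assumes f: "f \<noteq> p" "direction\<^sub>0 f = 0"
  shows "direction f = - X f * lex_localization (I @ (e, \<alpha>) # J) direction\<^sub>0"
proof -
  obtain k where k: "k \<noteq> p" "direction k = lifted_direction k" "lifted_direction k \<noteq> 0"
    by (rule common_sign)
  have "direction f = - X f * lifted_direction p"
    by (intro line.value_at_parallel[OF ends_in_line(1) _ _ direction(1,2)
          lifted_direction_in_line _ k])
      (simp_all add: lifted_direction_def ends_at_p ends_at_e e_neq_p direction\<^sub>0(3) f)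
  then show ?thesis by (simp add: lifted_direction_def)
qed

end

end

section \<open>Directed cycles in lexicographic extensions\<close>

locale lexicographic_cycle =
  fixes E :: "'a set" and L :: "'a sign_vec set" and I :: "('a \<times> int) list" and p :: 'a
    and L' :: "'a sign_vec set" and f :: 'a and Ps :: "'a sign_vec list"
  assumes euclidean: "euclidean_om E L"
    and lexicographic_extension: "lexicographic_extension E L I p L'"
    and objective_in_ground: "f \<in> E"
    and directed_cycle: "directed_cycle (insert p E) L' p f Ps"
begin

lemma list_elements: "fst ` set I \<subseteq> E" "snd ` set I \<subseteq> {1, -1}"
  using lexicographic_extension by (simp_all add: lexicographic_extension_def)

sublocale localized_extension E L p L' "lex_localization I"
proof
  show "oriented_matroid E L" using euclidean by (simp add: euclidean_om_def)
  show "single_element_extension E L p (lex_localization I) L'"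
    using lexicographic_extension by (simp add: lexicographic_extension_def)
  then show "oriented_matroid (insert p E) L'" by (simp add: single_element_extension_def)
qed

abbreviation "direction \<equiv> edge_direction L' p"

lemma walk: "closed_walk (insert p E) L' p 1 Ps"
  and direction_nonneg: "(X, Y) \<in> walk_edges Ps \<Longrightarrow> 0 \<le> direction X Y f"
  and exists_directed_edge: "\<exists>(X, Y)\<in>walk_edges Ps. direction X Y f \<noteq> 0"
  using directed_cycle by (auto simp: ext.directed_cycle_iff)

lemma f_neq_p: "f \<noteq> p"
  using objective_in_ground new_element by auto

lemma vertex:
  assumes "V \<in> set Ps"
  shows "V \<in> cocircuits L'" "V \<in> L'" "V p = 1" "V(p := 0) \<in> cocircuits L"
  using closed_walk_vertex[OF walk assms] delete_cocircuit by (simp_all add: cocircuits_def)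

definition "objective = hd Ps f"

lemma objective_value: "V \<in> set Ps \<Longrightarrow> V f = objective"
  unfolding objective_def by (rule ext.closed_walk_objective_constant[OF walk])
    (auto intro: direction_nonneg)

lemma objective_sign: "objective = 1 \<or> objective = -1"
proof -
  obtain X Y where XY: "(X, Y) \<in> walk_edges Ps" and nz: "direction X Y f \<noteq> 0"
    using exists_directed_edge by blast
  have at_f: "X f = objective" "Y f = objective" using objective_value walk_edges_in_set[OF XY] by blast+
  have "objective \<noteq> 0"
  proof
    assume "objective = 0"
    then have "direction X Y f = 0"
      using at_f closed_walk_edge[OF walk XY] by (simp add: ext.edge_direction_apply sv_comp_def)
    with nz show False ..
  qed
  then show ?thesis
    using at_f(1) ext.covector_sign[OF vertex(2)[OF walk_edges_in_set(1)[OF XY]], of f] by auto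
qed

lemma first_nonvanishing_list_element:
  obtains I\<^sub>1 e \<alpha> J where "I = I\<^sub>1 @ (e, \<alpha>) # J" "\<exists>V\<in>set Ps. V e \<noteq> 0"
    "\<forall>d\<in>fst ` set I\<^sub>1. \<forall>V\<in>set Ps. V d = 0"
proof -
  have "\<exists>x\<in>set I. \<exists>V\<in>set Ps. V (fst x) \<noteq> 0"
  proof (rule ccontr)
    assume none: "\<not> ?thesis"
    have V: "hd Ps \<in> set Ps" using walk by (simp add: closed_walk_def)
    have "lex_localization I ((hd Ps)(p := 0)) = 0"
      using none V by (intro lex_localization_eq_zero) auto
    then show False using value_at_new_element[OF vertex(2,4)[OF V]] vertex(3)[OF V] by simp
  qed
  from split_list_first_prop[OF this] obtain I\<^sub>1 x J
    where "I = I\<^sub>1 @ x # J" "\<exists>V\<in>set Ps. V (fst x) \<noteq> 0" "\<forall>y\<in>set I\<^sub>1. \<not> (\<exists>V\<in>set Ps. V (fst y) \<noteq> 0)"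
    by blast
  then show thesis using that[of I\<^sub>1 "fst x" "snd x" J] by auto
qed

context
  fixes I\<^sub>1 e \<alpha> J
  assumes split: "I = I\<^sub>1 @ (e, \<alpha>) # J"
    and initial_zero: "\<forall>d\<in>fst ` set I\<^sub>1. \<forall>V\<in>set Ps. V d = 0"
    and nonvanishing: "\<exists>V\<in>set Ps. V e \<noteq> 0"
begin

lemma split_sign: "\<alpha> = 1 \<or> \<alpha> = -1"
  using list_elements(2) by (simp add: split)

lemma split_extension: "split_lexicographic_extension E L p L' I\<^sub>1 e \<alpha> J"
proof -
  interpret split: localized_extension E L p L' "lex_localization (I\<^sub>1 @ (e, \<alpha>) # J)"
    using localized_extension_axioms by (simp add: split)
  show ?thesis
    using list_elements(1) new_element split_sign by unfold_locales (auto simp: split)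
qed

lemma walk_edge_lexicographic:
  assumes XY: "(X, Y) \<in> walk_edges Ps"
  shows "lexicographic_edge E L p L' I\<^sub>1 e \<alpha> J X Y"
proof -
  interpret split_lexicographic_extension E L p L' I\<^sub>1 e \<alpha> J by (rule split_extension)
  show ?thesis
    using closed_walk_edge[OF walk XY] walk_edges_in_set[OF XY] initial_zero by unfold_locales blast+
qed

text \<open>All edges between \<open>e = 0\<close> and \<open>e \<noteq> 0\<close> are directed the same way, so a closed walk has none.\<close>

lemma vertex_nonzero_at_e:
  assumes V: "V \<in> set Ps"
  shows "V e \<noteq> 0"
proof -
  let ?height = "\<lambda>V. if V e = 0 then 0 else - objective"
  have mono: "?height X \<le> ?height Y" if XY: "(X, Y) \<in> walk_edges Ps" for X Y
  proof -
    interpret edge: lexicographic_edge E L p L' I\<^sub>1 e \<alpha> J X Y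
      by (rule walk_edge_lexicographic[OF XY])
    have "X f = objective" "Y f = objective" using objective_value walk_edges_in_set[OF XY] by blast+
    then show ?thesis
      using direction_nonneg[OF XY] objective_sign
        edge.direction_leaving[OF _ _ f_neq_p] edge.direction_entering[OF _ _ f_neq_p] by auto
  qed
  have "?height W = ?height (hd Ps)" if "W \<in> set Ps" for W
    using that walk by (intro closed_walk_mono_constant[where a = ?height] mono)
      (auto simp: closed_walk_def)
  then have "?height V = ?height W" if "W \<in> set Ps" for W using V that by metis
  then show ?thesis using nonvanishing objective_sign by (fastforce split: if_splits)
qed

lemma vertex_at_e:
  assumes V: "V \<in> set Ps"
  shows "V e = \<alpha>"
  by (rule split_lexicographic_extension.cocircuit_value_at_e[OF split_extension vertex(1,3)[OF V]])
    (use V initial_zero vertex_nonzero_at_e in auto)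

abbreviation "direction\<^sub>0 X Y \<equiv> edge_direction L e (X(p := 0)) (Y(p := 0))"

lemma base_walk: "closed_walk E L e \<alpha> (map (\<lambda>V. V(p := 0)) Ps)"
  using split_lexicographic_extension.e_neq_p[OF split_extension] vertex_at_e
  by (intro closed_walk_deletion[OF walk]) simp_all

lemma direction_agrees:
  assumes XY: "(X, Y) \<in> walk_edges Ps" and "direction\<^sub>0 X Y f \<noteq> 0"
  shows "direction X Y f = direction\<^sub>0 X Y f"
  using assms walk_edges_in_set[OF XY] vertex_nonzero_at_e
  by (intro lexicographic_edge.direction_agrees[OF walk_edge_lexicographic[OF XY]] f_neq_p) simp_all

lemma base_direction_zero:
  assumes XY: "(X, Y) \<in> walk_edges Ps"
  shows "direction\<^sub>0 X Y f = 0"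
proof -
  have "0 \<le> direction\<^sub>0 V W f" if "(V, W) \<in> walk_edges Ps" for V W
    using direction_nonneg[OF that] direction_agrees[OF that] by (cases "direction\<^sub>0 V W f = 0") auto
  then show ?thesis
    using XY
    by (intro base.closed_walk_direction_zero[OF euclidean objective_in_ground base_walk split_sign,
          where s = 1])
      (auto simp: walk_edges_map)
qed

lemma direction_eq_localization:
  assumes XY: "(X, Y) \<in> walk_edges Ps"
  shows "direction X Y f = - objective * lex_localization I (direction\<^sub>0 X Y)"
proof -
  have "direction X Y f = - X f * lex_localization I (direction\<^sub>0 X Y)"
    unfolding split using walk_edges_in_set[OF XY] vertex_nonzero_at_e base_direction_zero[OF XY]
    by (intro lexicographic_edge.direction_at_parallel[OF walk_edge_lexicographic[OF XY]] f_neq_p)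
      simp_all
  then show ?thesis using objective_value walk_edges_in_set[OF XY] by simp
qed

lemma base_localization_zero:
  assumes XY: "(X, Y) \<in> walk_edges Ps"
  shows "lex_localization I (direction\<^sub>0 X Y) = 0"
proof -
  have "0 \<le> - objective * lex_localization I (direction\<^sub>0 V W)" if "(V, W) \<in> walk_edges Ps" for V W
    using direction_nonneg[OF that] direction_eq_localization[OF that] by simp
  moreover have "- objective = 1 \<or> - objective = -1" using objective_sign by auto
  ultimately show ?thesis
    using XY
    by (intro base.closed_walk_lex_localization_zero[OF euclidean base_walk split_sign _
          list_elements, where s = "- objective"])
      (auto simp: walk_edges_map)
qed

end

lemma contradiction: False
proof (rule first_nonvanishing_list_element)
  fix I\<^sub>1 e \<alpha> J
  assume split: "I = I\<^sub>1 @ (e, \<alpha>) # J" "\<exists>V\<in>set Ps. V e \<noteq> 0"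
    and initial_zero: "\<forall>d\<in>fst ` set I\<^sub>1. \<forall>V\<in>set Ps. V d = 0"
  have "direction X Y f = 0" if XY: "(X, Y) \<in> walk_edges Ps" for X Y
    using direction_eq_localization[OF split(1) initial_zero split(2) XY]
      base_localization_zero[OF split(1) initial_zero split(2) XY] by simp
  then show False using exists_directed_edge by blast
qed

end

theorem theorem1p1:
  fixes E :: "'a set" and L L' :: "'a sign_vec set" and I :: "('a \<times> int) list" and p :: 'a
  assumes "euclidean_om E L"
    and "lexicographic_extension E L I p L'"
  shows "\<forall>f\<in>E. om_program (insert p E) L' p f \<longrightarrow> euclidean_program (insert p E) L' p f"
proof (intro ballI impI)
  fix f assume "f \<in> E" and program: "om_program (insert p E) L' p f"
  have "\<not> directed_cycle (insert p E) L' p f Ps" for Ps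
  proof
    assume "directed_cycle (insert p E) L' p f Ps"
    then interpret lexicographic_cycle E L I p L' f Ps
      using assms \<open>f \<in> E\<close> by unfold_locales
    show False by (rule contradiction)
  qed
  then show "euclidean_program (insert p E) L' p f"
    using program by (simp add: euclidean_program_def)
qed

end
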